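(* There exists an absolute constant $C_2>0$ with the following property. Let $u\in L^2([0,T]\times\mathbb{T}^3_L)$ be an incompressible vector field (i.e. $\nabla_x\cdot u=0$ in the sense of distributions) with $\overline{\varepsilon}=\sup_q\lambda_q\langle|u_q|^3\rangle<\infty$. Then for every $\delta>0$ there is an adimensional constant $C_\delta>0$ such that $$S_2(\ell)\le C_2\,\overline{\varepsilon}^{\frac23}\,\ell^{\frac23}\left[\left(\frac{\ell}{L}\right)^{1-\frac D3-\delta}+C_\delta\left(\frac{\ell}{L}\right)^{\frac43}\right]$$ holds for all $0<\ell<L$.
   Context: **Setting.** $L,T>0$; $\mathbb{T}^3_L$ is the three-dimensional torus of side length $L$; $\Omega_T=[0,T]\times\mathbb{T}^3_L$; $\langle f\rangle=\frac{1}{TL^3}\int_{\Omega_T}f\,dx\,dt$. **Littlewood-Paley decomposition.** Fix a nonnegative radial $\chi\in C_0^\infty(B(0,1))$ on $\mathbb{R}^3$ with $\chi(\xi)=1$ for $|\xi|\le 1/2$, and $\phi(\xi)=\chi(\xi/2)-\chi(\xi)$. Let $\varphi_{-1}(\xi)=\chi(L\xi)$, $\varphi_q(\xi)=\phi(L\xi/2^q)$ for $q\ge 0$. With Fourier coefficients $\mathcal F(u)(k)=L^{-3}\int_{\mathbb{T}^3_L}u(x)e^{-2\pi i k\cdot x}dx$, $k\in\frac1L\mathbb{Z}^3$, set $u_q=\sum_{k\in\frac1L\mathbb{Z}^3}\varphi_q(k)\mathcal F(u)(k)e^{2\pi i k\cdot x}$ (acting in the space variable), so $u=\sum_{q\ge-1}u_q$.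 Put $\lambda_q=2^q/L$. The supremum defining $\overline\varepsilon$ is over $q\ge0$. **Intermittency dimension.** $V_q=L^3\dfrac{\langle|u_q|^2\rangle^3}{\langle|u_q|^3\rangle^2}$; $D_q=3-\dfrac{\log_2(L^3/V_q)}{q}$ for $q\ge1$; $D=\limsup_{q\to\infty}D_q$. Convention: if $u_q=0$ a.e. then $V_q=0$ and $D_q=-\infty$; if $D=-\infty$ the term $(\ell/L)^{1-D/3-\delta}$ is read as $0$. **Structure function.** $\delta_yu(t,x)=u(t,x+y)-u(t,x)$ and, for $0<\ell\le L$, $$S_2(\ell)=\frac1{4\pi}\int_{\mathbb{S}^2}\langle|\delta_{\ell\theta}u|^2\rangle\,d\theta .$$ **Constants.** "Absolute" means depending only on the fixed function $\chi$. "Adimensional" means a dimensionless number; $C_\delta$ is chosen after $u$ and $\delta$ (it may depend on both) and is independent of $\ell$. *)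

theory Defs
  imports "HOL-Analysis.Analysis"
begin

section \<open>The space-time domain\<close>

text \<open>Fields on \<open>[0,T] \<times> \<bbbT>\<^sup>3\<^sub>L\<close> are functions of \<open>(t,x)\<close> that are \<open>L\<close>-periodic in \<open>x\<close>;
  integrals over the torus are integrals over the fundamental cell.\<close>

definition cell :: "real \<Rightarrow> (real^3) set" where
  "cell L = cbox 0 (\<chi> i. L)"

definition Omega :: "real \<Rightarrow> real \<Rightarrow> (real \<times> (real^3)) set" where
  "Omega T L = {0..T} \<times> cell L"

definition space_periodic :: "real \<Rightarrow> real set \<Rightarrow> (real \<times> (real^3) \<Rightarrow> 'b) \<Rightarrow> bool" where
  "space_periodic L I f \<longleftrightarrow>
     (\<forall>t\<in>I. \<forall>x. \<forall>i::3. f (t, x + axis i L) = f (t, x))"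

text \<open>The average \<open>\<langle>f\<rangle>\<close> of a nonnegative function; it may be infinite.\<close>

definition avg :: "real \<Rightarrow> real \<Rightarrow> (real \<times> (real^3) \<Rightarrow> ennreal) \<Rightarrow> ennreal" where
  "avg T L f = (\<integral>\<^sup>+ z\<in>Omega T L. f z \<partial>lebesgue) / ennreal (T * L ^ 3)"

definition L2_field :: "real \<Rightarrow> real \<Rightarrow> (real \<times> (real^3) \<Rightarrow> real^3) \<Rightarrow> bool" where
  "L2_field T L u \<longleftrightarrow>
     space_periodic L {0..T} u \<and>
     u \<in> borel_measurable (lebesgue_on (Omega T L)) \<and>
     integrable (lebesgue_on (Omega T L)) (\<lambda>z. (norm (u z))\<^sup>2)"


section \<open>Smooth functions and the weak divergence\<close>

primrec C_k :: "nat \<Rightarrow> ('a::euclidean_space \<Rightarrow> real) \<Rightarrow> bool" where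
  "C_k 0 f \<longleftrightarrow> continuous_on UNIV f"
| "C_k (Suc n) f \<longleftrightarrow>
     (\<forall>x. f differentiable at x) \<and>
     (\<forall>b\<in>Basis. C_k n (\<lambda>x. frechet_derivative f (at x) b))"

definition smooth :: "('a::euclidean_space \<Rightarrow> real) \<Rightarrow> bool" where
  "smooth f \<longleftrightarrow> (\<forall>n. C_k n f)"

text \<open>Test functions on \<open>(0,T) \<times> \<bbbT>\<^sup>3\<^sub>L\<close>: compact support is a condition on \<open>t\<close> only.\<close>

definition test_function :: "real \<Rightarrow> real \<Rightarrow> (real \<times> (real^3) \<Rightarrow> real) \<Rightarrow> bool" where
  "test_function T L \<psi> \<longleftrightarrow>
     smooth \<psi> \<and> space_periodic L UNIV \<psi> \<and>
     (\<exists>a b. 0 < a \<and> b < T \<and> (\<forall>t x. t \<notin> {a..b} \<longrightarrow> \<psi> (t, x) = 0))"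

text \<open>The derivative of \<open>\<psi>\<close> in the direction \<open>(0, u)\<close> is \<open>u \<cdot> \<nabla>\<^sub>x \<psi>\<close>.\<close>

definition incompressible :: "real \<Rightarrow> real \<Rightarrow> (real \<times> (real^3) \<Rightarrow> real^3) \<Rightarrow> bool" where
  "incompressible T L u \<longleftrightarrow>
     (\<forall>\<psi>. test_function T L \<psi> \<longrightarrow>
        (LINT z:Omega T L|lebesgue. frechet_derivative \<psi> (at z) (0, u z)) = 0)"


section \<open>Littlewood-Paley decomposition\<close>

definition lp_cutoff :: "(real^3 \<Rightarrow> real) \<Rightarrow> bool" where
  "lp_cutoff chi \<longleftrightarrow>
     smooth chi \<and> closure {\<xi>. chi \<xi> \<noteq> 0} \<subseteq> ball 0 1 \<and>
     (\<forall>\<xi>. 0 \<le> chi \<xi>) \<and>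
     (\<forall>\<xi> \<eta>. norm \<xi> = norm \<eta> \<longrightarrow> chi \<xi> = chi \<eta>) \<and>
     (\<forall>\<xi>. norm \<xi> \<le> 1 / 2 \<longrightarrow> chi \<xi> = 1)"

definition lp_phi :: "(real^3 \<Rightarrow> real) \<Rightarrow> real^3 \<Rightarrow> real" where
  "lp_phi chi \<xi> = chi (\<xi> /\<^sub>R 2) - chi \<xi>"

text \<open>Only the indices \<open>q \<ge> -1\<close> are meaningful.\<close>

definition lp_symbol :: "(real^3 \<Rightarrow> real) \<Rightarrow> real \<Rightarrow> int \<Rightarrow> real^3 \<Rightarrow> real" where
  "lp_symbol chi L q \<xi> =
     (if q = -1 then chi (L *\<^sub>R \<xi>) else lp_phi chi ((L / 2 ^ nat q) *\<^sub>R \<xi>))"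

definition freqs :: "real \<Rightarrow> (real^3) set" where
  "freqs L = {k. \<forall>i. L * k $ i \<in> \<int>}"

definition fourier_mode :: "real^3 \<Rightarrow> real^3 \<Rightarrow> complex" where
  "fourier_mode k x = exp (2 * of_real pi * \<i> * of_real (k \<bullet> x))"

definition fourier_coeff :: "real \<Rightarrow> (real^3 \<Rightarrow> real^3) \<Rightarrow> real^3 \<Rightarrow> complex^3" where
  "fourier_coeff L v k =
     (\<chi> i. (LINT x:cell L|lebesgue. of_real (v x $ i) * fourier_mode (- k) x) / of_real (L ^ 3))"

text \<open>The sum has finitely many nonzero terms, as the symbol is compactly supported.\<close>

definition lp_block ::
  "(real^3 \<Rightarrow> real) \<Rightarrow> real \<Rightarrow> int \<Rightarrow> (real \<times> (real^3) \<Rightarrow> real^3) \<Rightarrow> real \<times> (real^3) \<Rightarrow> complex^3"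
  where
  "lp_block chi L q u = (\<lambda>(t, x).
     \<Sum>\<^sub>\<infinity>k\<in>freqs L.
       (of_real (lp_symbol chi L q k) * fourier_mode k x) *s fourier_coeff L (\<lambda>y. u (t, y)) k)"

definition lambda :: "real \<Rightarrow> nat \<Rightarrow> real" where
  "lambda L q = 2 ^ q / L"

definition block_moment ::
  "(real^3 \<Rightarrow> real) \<Rightarrow> real \<Rightarrow> real \<Rightarrow> (real \<times> (real^3) \<Rightarrow> real^3) \<Rightarrow> nat \<Rightarrow> nat \<Rightarrow> ennreal" where
  "block_moment chi T L u p q = avg T L (\<lambda>z. ennreal (norm (lp_block chi L (int q) u z) ^ p))"

definition eps_bar ::
  "(real^3 \<Rightarrow> real) \<Rightarrow> real \<Rightarrow> real \<Rightarrow> (real \<times> (real^3) \<Rightarrow> real^3) \<Rightarrow> ennreal" where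
  "eps_bar chi T L u = (SUP q. ennreal (lambda L q) * block_moment chi T L u 3 q)"


section \<open>Intermittency dimension\<close>

text \<open>In \<^typ>\<open>ennreal\<close> one has \<open>0 / 0 = 0\<close>, so \<open>V\<^sub>q = 0\<close> when \<open>u\<^sub>q = 0\<close> a.e.
  If the third moment is finite, this is the only case in which \<open>V\<^sub>q = 0\<close>.\<close>

definition active_volume ::
  "(real^3 \<Rightarrow> real) \<Rightarrow> real \<Rightarrow> real \<Rightarrow> (real \<times> (real^3) \<Rightarrow> real^3) \<Rightarrow> nat \<Rightarrow> ennreal" where
  "active_volume chi T L u q =
     ennreal (L ^ 3) * block_moment chi T L u 2 q ^ 3 / block_moment chi T L u 3 q ^ 2"

definition dim_at ::
  "(real^3 \<Rightarrow> real) \<Rightarrow> real \<Rightarrow> real \<Rightarrow> (real \<times> (real^3) \<Rightarrow> real^3) \<Rightarrow> nat \<Rightarrow> ereal" where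
  "dim_at chi T L u q =
     (if active_volume chi T L u q = 0 then -\<infinity>
      else ereal (3 - log 2 (L ^ 3 / enn2real (active_volume chi T L u q)) / real q))"

definition intermittency_dim ::
  "(real^3 \<Rightarrow> real) \<Rightarrow> real \<Rightarrow> real \<Rightarrow> (real \<times> (real^3) \<Rightarrow> real^3) \<Rightarrow> ereal" where
  "intermittency_dim chi T L u = limsup (dim_at chi T L u)"

text \<open>\<open>(\<ell>/L)\<^bsup>1 - D/3 - \<delta>\<^esup>\<close>, read as \<open>0\<close> for \<open>D = -\<infinity>\<close>. The value \<open>D = \<infinity>\<close> does not
  occur: \<open>V\<^sub>q \<le> L\<^sup>3\<close> by Jensen's inequality, so \<open>D \<le> 3\<close>.\<close>

definition intermittency_factor :: "ereal \<Rightarrow> real \<Rightarrow> real \<Rightarrow> real" where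
  "intermittency_factor D \<delta> r =
     (if D = -\<infinity> then 0 else r powr (1 - real_of_ereal D / 3 - \<delta>))"


section \<open>Second-order structure function\<close>

definition increment :: "real^3 \<Rightarrow> (real \<times> (real^3) \<Rightarrow> real^3) \<Rightarrow> real \<times> (real^3) \<Rightarrow> real^3" where
  "increment y u = (\<lambda>(t, x). u (t, x + y) - u (t, x))"

text \<open>Surface integral over the unit sphere, in spherical coordinates
  (azimuth \<open>a\<close>, polar angle \<open>b\<close>, area element \<open>sin b\<close>).\<close>

definition sphere_integral :: "(real^3 \<Rightarrow> ennreal) \<Rightarrow> ennreal" where
  "sphere_integral f =
     (\<integral>\<^sup>+ a\<in>{0..2 * pi}.
        (\<integral>\<^sup>+ b\<in>{0..pi}.
           f (vector [sin b * cos a, sin b * sin a, cos b]) * ennreal (sin b) \<partial>lborel) \<partial>lborel)"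

definition structure_fun ::
  "real \<Rightarrow> real \<Rightarrow> (real \<times> (real^3) \<Rightarrow> real^3) \<Rightarrow> real \<Rightarrow> ennreal" where
  "structure_fun T L u l =
     sphere_integral (\<lambda>\<theta>. avg T L (\<lambda>z. ennreal ((norm (increment (l *\<^sub>R \<theta>) u z))\<^sup>2)))
       / ennreal (4 * pi)"

end

theory Submission
  imports Defs
begin

text \<open>
  The structure function is controlled by the second moments of the Littlewood-Paley blocks.
  For a fixed time and a vector \<open>y\<close>, Parseval's identity on the torus turns the increment into
  \<open>\<Sum>\<^sub>k |e\<^sub>k(y) - 1|\<^sup>2 |u\<^sub>k|\<^sup>2\<close>, where \<open>e\<^sub>k\<close> is the Fourier mode and \<open>u\<^sub>k\<close> the coefficient. Every
  frequency \<open>k \<noteq> 0\<close> has a level \<open>q\<close> whose symbol is at least \<open>1 / 2\<close> at \<open>k\<close>, because two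
  consecutive symbols add up to one; on its support \<open>|k| \<le> 2 \<lambda>\<^sub>q\<close>, so \<open>|e\<^sub>k(y) - 1|\<close> is at most a
  multiple of \<open>min 1 (\<lambda>\<^sub>q |y|)\<close>. Integrating in time gives (\<open>increment_le_blocks\<close>)

  \<open>\<langle>|\<delta>\<^sub>y u|\<^sup>2\<rangle> \<le> 128 \<pi>\<^sup>2 \<Sum>\<^sub>q min 1 ((\<lambda>\<^sub>q |y|)\<^sup>2) \<langle>|u\<^sub>q|\<^sup>2\<rangle>\<close>.

  The part of Parseval's identity that needs work is completeness: trigonometric polynomials are
  dense in \<open>L\<^sup>2\<close> of the cell (\<open>trig_dense\<close>). It is deduced from the Stone-Weierstrass theorem on
  the torus embedded in \<open>\<complex>\<^sup>3\<close>.

  The definitions of \<open>V\<^sub>q\<close>, \<open>D\<^sub>q\<close> and \<open>\<epsilon>\<close> (the supremum of \<open>\<lambda>\<^sub>q \<langle>|u\<^sub>q|\<^sup>3\<rangle>\<close>) combine to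
  \<open>\<langle>|u\<^sub>q|\<^sup>2\<rangle> \<le> \<epsilon>\<^bsup>2/3\<^esup> \<lambda>\<^sub>q\<^bsup>-2/3\<^esup> 2\<^bsup>-q(1 - D\<^sub>q/3)\<^esup>\<close> for \<open>q \<ge> 1\<close>. If \<open>d > D\<close>, then \<open>D\<^sub>q < d\<close> for all but
  finitely many \<open>q\<close>, and the exceptions only cost a factor depending on \<open>u\<close> and \<open>d\<close>
  (\<open>second_moment_decay\<close>). Since \<open>min 1 (x\<^sup>2) \<le> x\<^sup>\<theta>\<close> for \<open>0 \<le> \<theta> \<le> 2\<close>, the sum over \<open>q\<close> becomes a
  geometric series as soon as \<open>\<theta> < 5/3 - d/3\<close>, with the result
  \<open>S\<^sub>2(\<ell>) \<le> K \<epsilon>\<^bsup>2/3\<^esup> \<ell>\<^bsup>2/3\<^esup> (\<ell>/L)\<^bsup>\<theta> - 2/3\<^esup>\<close> (\<open>structure_fun_power_bound\<close>).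

  The constant \<open>K\<close> depends on \<open>u\<close>, whereas the constant in front of \<open>(\<ell>/L)\<^bsup>1 - D/3 - \<delta>\<^esup>\<close> has to be
  absolute. The \<open>\<delta>\<close> in the exponent resolves this: \<open>d\<close> and \<open>\<theta>\<close> can be chosen so that \<open>\<theta> - 2/3\<close> is
  strictly larger than \<open>1 - D/3 - \<delta>\<close>. Then \<open>K (\<ell>/L)\<^bsup>\<theta> - 2/3\<^esup> \<le> (\<ell>/L)\<^bsup>1 - D/3 - \<delta>\<^esup>\<close> for small \<open>\<ell>/L\<close>, and
  for the other \<open>\<ell>\<close> the term with \<open>C\<^sub>\<delta>\<close> takes over (\<open>absorb_larger_power\<close>); so \<open>C\<^sub>2 = 1\<close> works. If
  \<open>D < -1\<close>, in particular if \<open>D = -\<infinity>\<close>, the choice \<open>\<theta> = 2\<close> is admissible and the power \<open>4/3\<close> alone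
  suffices.
\<close>

section \<open>Translation on the torus\<close>

text \<open>Half-open, so that its translates by the period lattice tile the space without overlap.\<close>

definition half_open_cell :: "real \<Rightarrow> (real^3) set" where
  "half_open_cell L = {x. \<forall>i. 0 \<le> x $ i \<and> x $ i < L}"

definition period_lattice :: "real \<Rightarrow> (real^3) set" where
  "period_lattice L = range (\<lambda>n::int^3. \<chi> i. L * of_int (n $ i))"

definition lattice_part :: "real \<Rightarrow> real^3 \<Rightarrow> real^3" where
  "lattice_part L x = (\<chi> i. L * of_int \<lfloor>x $ i / L\<rfloor>)"

text \<open>The representative in \<open>half_open_cell L\<close> of the class of \<open>x\<close> modulo the period lattice.\<close>

definition wrap :: "real \<Rightarrow> real^3 \<Rightarrow> real^3" where
  "wrap L x = x - lattice_part L x"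

definition periodic :: "real \<Rightarrow> (real^3 \<Rightarrow> 'b) \<Rightarrow> bool" where
  "periodic L f \<longleftrightarrow> (\<forall>x i. f (x + axis i L) = f x)"

lemma countable_period_lattice: "countable (period_lattice L)"
  unfolding period_lattice_def by simp

lemma lattice_part_in_lattice: "lattice_part L x \<in> period_lattice L"
  unfolding period_lattice_def lattice_part_def
  by (rule range_eqI[of _ _ "\<chi> i. \<lfloor>x $ i / L\<rfloor>"]) simp

lemma uminus_in_lattice: "m \<in> period_lattice L \<Longrightarrow> - m \<in> period_lattice L"
  unfolding period_lattice_def
proof (elim rangeE)
  fix n :: "int^3" assume "m = (\<chi> i. L * of_int (n $ i))"
  then have "- m = (\<chi> i. L * of_int ((- n) $ i))" by (simp add: vec_eq_iff)
  then show "- m \<in> range (\<lambda>n::int^3. \<chi> i. L * of_int (n $ i))" by blast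
qed

lemma half_open_cell_translate_iff:
  assumes L: "L > 0" and m: "m \<in> period_lattice L"
  shows "z - m \<in> half_open_cell L \<longleftrightarrow> m = lattice_part L z"
proof -
  obtain n :: "int^3" where n: "m = (\<chi> i. L * of_int (n $ i))"
    using m unfolding period_lattice_def by blast
  have "0 \<le> z $ i - L * of_int (n $ i) \<and> z $ i - L * of_int (n $ i) < L \<longleftrightarrow> n $ i = \<lfloor>z $ i / L\<rfloor>" for i
  proof -
    have "0 \<le> z $ i - L * of_int (n $ i) \<and> z $ i - L * of_int (n $ i) < L
        \<longleftrightarrow> of_int (n $ i) \<le> z $ i / L \<and> z $ i / L < of_int (n $ i) + 1"
      using L by (simp add: field_simps)
    also have "\<dots> \<longleftrightarrow> \<lfloor>z $ i / L\<rfloor> = n $ i" by (simp add: floor_eq_iff)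
    finally show ?thesis by auto
  qed
  then have "z - m \<in> half_open_cell L \<longleftrightarrow> (\<forall>i. n $ i = \<lfloor>z $ i / L\<rfloor>)"
    by (simp add: half_open_cell_def n)
  also have "\<dots> \<longleftrightarrow> m = lattice_part L z"
    using L by (simp add: n lattice_part_def vec_eq_iff)
  finally show ?thesis .
qed

lemma wrap_in_half_open_cell: "L > 0 \<Longrightarrow> wrap L x \<in> half_open_cell L"
  unfolding wrap_def using half_open_cell_translate_iff[OF _ lattice_part_in_lattice, of L x x] by blast

lemma periodic_lattice:
  assumes f: "periodic L f" and m: "m \<in> period_lattice L"
  shows "f (x + m) = f x"
proof -
  have nat: "f (x + axis i (L * of_nat n)) = f x" for i n x
  proof (induction n arbitrary: x)
    case 0 then show ?case by (simp add: axis_def zero_vec_def[symmetric])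
  next
    case (Suc n)
    have "x + axis i (L * of_nat (Suc n)) = (x + axis i (L * of_nat n)) + axis i L"
      by (simp add: vec_eq_iff axis_def algebra_simps)
    then show ?case using f Suc by (metis periodic_def)
  qed
  have int: "f (x + axis i (L * of_int n)) = f x" for i n x
  proof (cases "0 \<le> n")
    case True
    then obtain k where "n = int k" using nonneg_int_cases by blast
    then show ?thesis using nat[of x i k] by simp
  next
    case False
    then obtain k where k: "n = - int k" by (metis nonneg_int_cases neg_0_le_iff_le minus_minus linear)
    have "x = (x + axis i (L * of_int n)) + axis i (L * of_nat k)"
      by (simp add: vec_eq_iff axis_def k)
    then show ?thesis using nat by metis
  qed
  obtain n :: "int^3" where n: "m = (\<chi> i. L * of_int (n $ i))"
    using m unfolding period_lattice_def by blast
  have "x + m = x + axis 1 (L * of_int (n $ 1)) + axis 2 (L * of_int (n $ 2)) + axis 3 (L * of_int (n $ 3))"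
    unfolding vec_eq_iff forall_3 by (simp add: n axis_def)
  then show ?thesis using int by metis
qed

lemma periodic_wrap: "periodic L f \<Longrightarrow> f (wrap L x) = f x"
  unfolding wrap_def
  using periodic_lattice[of L f "- lattice_part L x" x] uminus_in_lattice[OF lattice_part_in_lattice] by simp

lemma wrap_plus_lattice:
  assumes L: "L > 0" and m: "m \<in> period_lattice L"
  shows "wrap L (x + m) = wrap L x"
proof -
  obtain n :: "int^3" where n: "m = (\<chi> i. L * of_int (n $ i))"
    using m unfolding period_lattice_def by blast
  show ?thesis
    using L by (simp add: wrap_def lattice_part_def n vec_eq_iff add_divide_distrib algebra_simps)
qed

lemma axis_in_lattice: "axis i L \<in> period_lattice L"
  unfolding period_lattice_def
  by (rule range_eqI[of _ _ "axis i 1"]) (auto simp: vec_eq_iff axis_def)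

lemma periodic_comp_wrap: "L > 0 \<Longrightarrow> periodic L (\<lambda>x. g (wrap L x))"
  by (simp add: periodic_def wrap_plus_lattice axis_in_lattice)

lemma half_open_cell_sets [measurable]: "half_open_cell L \<in> sets borel"
proof -
  have "half_open_cell L = {x \<in> space borel. \<forall>i. 0 \<le> x $ i \<and> x $ i < L}" by (simp add: half_open_cell_def)
  also have "\<dots> \<in> sets borel" by measurable
  finally show ?thesis .
qed

lemma measurable_vec3:
  assumes "\<And>i. (\<lambda>x. f x $ i) \<in> borel_measurable M"
  shows "(f :: 'a \<Rightarrow> real^3) \<in> borel_measurable M"
proof (rule borel_measurable_euclidean_space[THEN iffD2], intro ballI)
  fix b :: "real^3" assume "b \<in> Basis"
  then obtain i where "b = axis i 1" by (auto simp: Basis_vec_def)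
  then show "(\<lambda>x. f x \<bullet> b) \<in> borel_measurable M"
    using assms[of i] by (simp add: inner_axis)
qed

lemma measurable_vec_component [measurable (raw)]:
  fixes f :: "'a \<Rightarrow> real^3"
  assumes "f \<in> borel_measurable M"
  shows "(\<lambda>x. f x $ i) \<in> borel_measurable M"
  by (rule measurable_compose[OF assms borel_measurable_continuous_onI]) (intro continuous_intros)

lemma measurable_cnj [measurable (raw)]:
  assumes "f \<in> borel_measurable M"
  shows "(\<lambda>x. cnj (f x)) \<in> borel_measurable M"
  by (rule measurable_compose[OF assms borel_measurable_continuous_onI]) (intro continuous_intros)

lemma wrap_measurable [measurable]: "wrap L \<in> borel_measurable borel"
  by (rule measurable_vec3) (simp add: wrap_def lattice_part_def)

lemma cell_sets [measurable]: "cell L \<in> sets borel"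
  by (simp add: cell_def)

lemma mem_cell: "x \<in> cell L \<longleftrightarrow> (\<forall>i. 0 \<le> x $ i \<and> x $ i \<le> L)"
  by (simp add: cell_def mem_box_cart)

lemma cell_AE_box: "AE x in lborel. x \<in> cell L \<longrightarrow> x \<in> box 0 (\<chi> i. L)"
proof -
  have "negligible (cell L - box 0 (\<chi> i. L))"
    unfolding cell_def by (rule negligible_frontier_interval)
  then have "AE x in lebesgue. x \<notin> cell L - box 0 (\<chi> i. L)"
    unfolding negligible_iff_null_sets by (rule AE_not_in)
  then have "AE x in lborel. x \<notin> cell L - box 0 (\<chi> i. L)"
    by (simp add: AE_completion_iff)
  then show ?thesis by eventually_elim auto
qed

lemma cell_AE_half_open_cell: "AE x in lborel. x \<in> cell L \<longleftrightarrow> x \<in> half_open_cell L"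
proof -
  have sub: "box 0 (\<chi> i. L) \<subseteq> half_open_cell L" "half_open_cell L \<subseteq> cell L"
    by (auto simp: mem_cell half_open_cell_def mem_box_cart less_imp_le)
  show ?thesis
    using cell_AE_box[of L] by eventually_elim (use sub in blast)
qed

lemma emeasure_lborel_translate:
  fixes c :: "'a::euclidean_space"
  assumes [measurable]: "S \<in> sets borel"
  shows "emeasure lborel {x. x + c \<in> S} = emeasure lborel S"
proof -
  have "emeasure lborel S = emeasure (distr lborel borel ((+) c)) S"
    by (simp add: lborel_distr_plus)
  also have "\<dots> = emeasure lborel {x. x + c \<in> S}"
    by (subst emeasure_distr) (auto intro!: arg_cong[where f="emeasure lborel"] simp: add.commute)
  finally show ?thesis by simp
qed

text \<open>Both \<open>half_open_cell L\<close> and its translate are fundamental domains for the period lattice: cutting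
  the translate along the lattice and moving the pieces back reassembles \<open>half_open_cell L\<close>.\<close>

lemma emeasure_half_open_cell_translate:
  assumes L: "L > 0" and A[measurable]: "A \<in> sets borel"
    and per: "\<And>x m. m \<in> period_lattice L \<Longrightarrow> x + m \<in> A \<longleftrightarrow> x \<in> A"
  shows "emeasure lborel {x \<in> half_open_cell L. x + y \<in> A} = emeasure lborel {x \<in> half_open_cell L. x \<in> A}"
proof -
  let ?I = "period_lattice L"
  define B where "B = {z. z - y \<in> half_open_cell L \<and> z \<in> A}"
  define Bm where "Bm m = {z \<in> B. z - m \<in> half_open_cell L}" for m
  define Cm where "Cm m = {z. z + m \<in> Bm m}" for m
  have bs[measurable]: "B \<in> sets borel"
  proof -
    have "B = {z \<in> space borel. z - y \<in> half_open_cell L \<and> z \<in> A}" by (simp add: B_def)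
    also have "\<dots> \<in> sets borel" by measurable
    finally show ?thesis .
  qed
  have bms[measurable]: "Bm m \<in> sets borel" for m
  proof -
    have "Bm m = {z \<in> space borel. z \<in> B \<and> z - m \<in> half_open_cell L}" by (simp add: Bm_def)
    also have "\<dots> \<in> sets borel" by measurable
    finally show ?thesis .
  qed
  have cms[measurable]: "Cm m \<in> sets borel" for m
  proof -
    have "Cm m = {z \<in> space borel. z + m \<in> Bm m}" by (simp add: Cm_def)
    also have "\<dots> \<in> sets borel" by measurable
    finally show ?thesis .
  qed
  have Cm_iff: "z \<in> Cm m \<longleftrightarrow> z \<in> half_open_cell L \<and> z \<in> A \<and> - m = lattice_part L (z - y)" if m: "m \<in> ?I" for z m
    using per[OF m, of z] half_open_cell_translate_iff[OF L uminus_in_lattice[OF m], of "z - y"]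
    by (auto simp: Cm_def Bm_def B_def algebra_simps)
  have "{x \<in> half_open_cell L. x + y \<in> A} = {x. x + y \<in> B}" by (auto simp: B_def)
  then have "emeasure lborel {x \<in> half_open_cell L. x + y \<in> A} = emeasure lborel B"
    by (simp add: emeasure_lborel_translate)
  also have "B = (\<Union>m\<in>?I. Bm m)"
    using lattice_part_in_lattice half_open_cell_translate_iff[OF L] by (fastforce simp: Bm_def)
  also have "emeasure lborel \<dots> = (\<integral>\<^sup>+m. emeasure lborel (Bm m) \<partial>count_space ?I)"
  proof (intro emeasure_UN_countable countable_period_lattice)
    show "disjoint_family_on Bm ?I"
      using half_open_cell_translate_iff[OF L] by (auto simp: disjoint_family_on_def Bm_def)
  qed simp
  also have "\<dots> = (\<integral>\<^sup>+m. emeasure lborel (Cm m) \<partial>count_space ?I)"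
    by (simp add: Cm_def emeasure_lborel_translate)
  also have "\<dots> = emeasure lborel (\<Union>m\<in>?I. Cm m)"
    by (intro emeasure_UN_countable[symmetric] countable_period_lattice)
      (simp, auto simp: disjoint_family_on_def Cm_iff, metis neg_equal_iff_equal)
  also have "(\<Union>m\<in>?I. Cm m) = {x \<in> half_open_cell L. x \<in> A}"
    using Cm_iff uminus_in_lattice[OF lattice_part_in_lattice] by fastforce
  finally show ?thesis .
qed

abbreviation cell_measure :: "real \<Rightarrow> (real^3) measure" where
  "cell_measure L \<equiv> restrict_space lborel (cell L)"

text \<open>As an equality of image measures, translation invariance yields both the statement on
  nonnegative integrals and the one on complex integrals.\<close>

lemma distr_wrap_translate:
  assumes L: "L > 0"
  shows "distr (cell_measure L) borel (\<lambda>x. wrap L (x + y)) = distr (cell_measure L) borel (wrap L)"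
proof (rule measure_eqI)
  fix A assume "A \<in> sets (distr (cell_measure L) borel (\<lambda>x. wrap L (x + y)))"
  then have A[measurable]: "A \<in> sets borel" by simp
  have *: "emeasure (distr (cell_measure L) borel (\<lambda>x. wrap L (x + y))) A
      = emeasure lborel {x \<in> half_open_cell L. wrap L (x + y) \<in> A}" for y
  proof -
    have m1: "(\<lambda>x. wrap L (x + y)) \<in> borel_measurable (cell_measure L)"
      by (intro measurable_restrict_space1) measurable
    have m2: "{x \<in> half_open_cell L. wrap L (x + y) \<in> A} \<in> sets lborel"
      "{x \<in> cell L. wrap L (x + y) \<in> A} \<in> sets lborel"
    proof -
      have "{x \<in> space borel. x \<in> half_open_cell L \<and> wrap L (x + y) \<in> A} \<in> sets borel"
        "{x \<in> space borel. x \<in> cell L \<and> wrap L (x + y) \<in> A} \<in> sets borel"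
        by measurable
      then show "{x \<in> half_open_cell L. wrap L (x + y) \<in> A} \<in> sets lborel"
        "{x \<in> cell L. wrap L (x + y) \<in> A} \<in> sets lborel" by simp_all
    qed
    have "emeasure (distr (cell_measure L) borel (\<lambda>x. wrap L (x + y))) A
        = emeasure (cell_measure L) {x \<in> cell L. wrap L (x + y) \<in> A}"
      by (subst emeasure_distr[OF m1]) (auto simp: space_restrict_space intro!: arg_cong[where f="emeasure _"])
    also have "\<dots> = emeasure lborel {x \<in> cell L. wrap L (x + y) \<in> A}"
      by (rule emeasure_restrict_space) auto
    also have "\<dots> = emeasure lborel {x \<in> half_open_cell L. wrap L (x + y) \<in> A}"
      using cell_AE_half_open_cell[of L] by (intro emeasure_eq_AE m2) auto
    finally show ?thesis .
  qed
  have P: "wrap L -` A \<in> sets borel" using measurable_sets[OF wrap_measurable A] by simp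
  have "emeasure lborel {x \<in> half_open_cell L. x + y \<in> wrap L -` A} = emeasure lborel {x \<in> half_open_cell L. x \<in> wrap L -` A}"
    by (rule emeasure_half_open_cell_translate[OF L P]) (simp add: wrap_plus_lattice[OF L])
  then show "emeasure (distr (cell_measure L) borel (\<lambda>x. wrap L (x + y))) A
      = emeasure (distr (cell_measure L) borel (wrap L)) A"
    using *[of y] *[of 0] by simp
qed simp

lemma nn_integral_cell_translate:
  assumes L: "L > 0" and f: "periodic L f" and [measurable]: "f \<in> borel_measurable borel"
  shows "(\<integral>\<^sup>+x. f (x + y) \<partial>cell_measure L) = (\<integral>\<^sup>+x. f x \<partial>cell_measure L)"
proof -
  have m: "(\<lambda>x. wrap L (x + y)) \<in> borel_measurable (cell_measure L)" for y
    by (intro measurable_restrict_space1) measurable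
  have "(\<integral>\<^sup>+x. f (x + y) \<partial>cell_measure L) = (\<integral>\<^sup>+x. f x \<partial>distr (cell_measure L) borel (\<lambda>x. wrap L (x + y)))" for y
    by (subst nn_integral_distr[OF m]) (simp_all add: periodic_wrap[OF f])
  from this[of y] this[of 0] show ?thesis using distr_wrap_translate[OF L, of y] by simp
qed

lemma integral_cell_translate:
  fixes f :: "real^3 \<Rightarrow> complex"
  assumes L: "L > 0" and f: "periodic L f" and [measurable]: "f \<in> borel_measurable borel"
  shows "(LINT x|cell_measure L. f (x + y)) = (LINT x|cell_measure L. f x)"
proof -
  have m: "(\<lambda>x. wrap L (x + y)) \<in> borel_measurable (cell_measure L)" for y
    by (intro measurable_restrict_space1) measurable
  have "(LINT x|cell_measure L. f (x + y)) = (LINT x|distr (cell_measure L) borel (\<lambda>x. wrap L (x + y)). f x)" for y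
    by (subst integral_distr[OF m]) (simp_all add: periodic_wrap[OF f])
  from this[of y] this[of 0] show ?thesis using distr_wrap_translate[OF L, of y] by simp
qed

lemma emeasure_cell: "L > 0 \<Longrightarrow> emeasure lborel (cell L) = ennreal (L ^ 3)"
  by (simp add: cell_def emeasure_lborel_cbox_eq Basis_vec_def inner_axis UNION_singleton_eq_range)
    (simp add: prod.reindex inj_on_def axis_eq_axis card_image inner_axis)

section \<open>Fourier modes\<close>

lemma cell_measure_borel: "f \<in> borel_measurable borel \<Longrightarrow> f \<in> borel_measurable (cell_measure L)"
  by (intro measurable_restrict_space1) simp

lemma finite_measure_cell: "finite_measure (cell_measure L)"
  by (rule finite_measureI)
    (simp add: space_restrict_space emeasure_restrict_space, simp add: cell_def emeasure_lborel_cbox_eq)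

lemma measure_cell: "L > 0 \<Longrightarrow> measure (cell_measure L) (space (cell_measure L)) = L ^ 3"
  by (simp add: measure_def space_restrict_space emeasure_restrict_space emeasure_cell)

lemma fourier_mode_measurable [measurable]: "fourier_mode k \<in> borel_measurable borel"
  unfolding fourier_mode_def
  by (intro borel_measurable_continuous_onI continuous_intros)

lemma norm_fourier_mode [simp]: "norm (fourier_mode k x) = 1"
  by (simp add: fourier_mode_def)

lemma fourier_mode_add_right: "fourier_mode k (x + y) = fourier_mode k x * fourier_mode k y"
  by (simp add: fourier_mode_def inner_add_right distrib_left exp_add)

lemma fourier_mode_add_left: "fourier_mode (j + k) x = fourier_mode j x * fourier_mode k x"
  by (simp add: fourier_mode_def inner_add_left distrib_left exp_add)

lemma fourier_mode_minus: "fourier_mode (- k) x = cnj (fourier_mode k x)"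
  by (simp add: fourier_mode_def exp_cnj)

lemma fourier_mode_zero [simp]: "fourier_mode 0 x = 1"
  by (simp add: fourier_mode_def)

lemma freqs_closed:
  "0 \<in> freqs L" "j \<in> freqs L \<Longrightarrow> k \<in> freqs L \<Longrightarrow> j + k \<in> freqs L" "k \<in> freqs L \<Longrightarrow> - k \<in> freqs L"
  "j \<in> freqs L \<Longrightarrow> k \<in> freqs L \<Longrightarrow> j - k \<in> freqs L"
  by (auto simp: freqs_def distrib_left right_diff_distrib)

lemma fourier_mode_periodic:
  assumes k: "k \<in> freqs L"
  shows "periodic L (fourier_mode k)"
proof -
  have "fourier_mode k (axis i L) = 1" for i
  proof -
    obtain n :: int where n: "L * k $ i = of_int n" using k by (auto simp: freqs_def elim: Ints_cases)
    have "fourier_mode k (axis i L) = exp (2 * of_real pi * \<i> * of_int n)"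
      using n by (simp add: fourier_mode_def inner_axis mult.commute[of "k $ i"] flip: of_real_mult)
    also have "\<dots> = 1" by (simp add: exp_eq_1)
    finally show ?thesis .
  qed
  then show ?thesis by (simp add: periodic_def fourier_mode_add_right)
qed

lemma fourier_mode_nontrivial:
  assumes "k \<noteq> 0"
  shows "\<exists>y. fourier_mode k y \<noteq> 1"
proof -
  have "fourier_mode k ((1 / (2 * (k \<bullet> k))) *\<^sub>R k) = exp (pi * \<i>)"
    using assms by (simp add: fourier_mode_def)
  then have "fourier_mode k ((1 / (2 * (k \<bullet> k))) *\<^sub>R k) = -1"
    by (simp add: exp_pi_i)
  then show ?thesis by (metis one_neq_neg_one)
qed

text \<open>Translating by a vector with \<open>e\<^sub>k y \<noteq> 1\<close> multiplies the integral of \<open>e\<^sub>k\<close> by that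
  number, so the integral vanishes.\<close>

lemma integral_fourier_mode:
  assumes L: "L > 0" and k: "k \<in> freqs L"
  shows "(LINT x|cell_measure L. fourier_mode k x) = (if k = 0 then of_real (L ^ 3) else 0)"
proof (cases "k = 0")
  case True
  interpret finite_measure "cell_measure L" by (rule finite_measure_cell)
  show ?thesis using True measure_cell[OF L] by (simp add: scaleR_conv_of_real)
next
  case False
  then obtain y where y: "fourier_mode k y \<noteq> 1" using fourier_mode_nontrivial by blast
  have "(LINT x|cell_measure L. fourier_mode k x) = (LINT x|cell_measure L. fourier_mode k (x + y))"
    by (rule integral_cell_translate[OF L fourier_mode_periodic[OF k], symmetric]) simp
  also have "\<dots> = (LINT x|cell_measure L. fourier_mode k x) * fourier_mode k y"
    by (simp add: fourier_mode_add_right)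
  finally show ?thesis using y False by (auto simp: mult_cancel_left1)
qed

lemma fourier_mode_orthogonal:
  assumes "L > 0" "j \<in> freqs L" "k \<in> freqs L"
  shows "(LINT x|cell_measure L. fourier_mode j x * cnj (fourier_mode k x)) = (if j = k then of_real (L ^ 3) else 0)"
  using integral_fourier_mode[OF assms(1) freqs_closed(4)[OF assms(2,3)]]
  by (simp add: fourier_mode_minus[symmetric] fourier_mode_add_left[symmetric])

abbreviation trig_sum :: "(real^3) set \<Rightarrow> (real^3 \<Rightarrow> complex) \<Rightarrow> real^3 \<Rightarrow> complex" where
  "trig_sum F c x \<equiv> (\<Sum>k\<in>F. c k * fourier_mode k x)"

lemma integrable_cell_bounded:
  fixes f :: "real^3 \<Rightarrow> 'b::{banach,second_countable_topology}"
  assumes "f \<in> borel_measurable borel" "\<And>x. norm (f x) \<le> B"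
  shows "integrable (cell_measure L) f"
  using assms by (intro finite_measure.integrable_const_bound[OF finite_measure_cell, of _ B] cell_measure_borel) auto

lemma norm_trig_sum_le: "norm (trig_sum F c x) \<le> (\<Sum>k\<in>F. norm (c k))"
  by (rule order_trans[OF norm_sum]) (simp add: norm_mult)

lemma parseval_trig_sum:
  assumes L: "L > 0" and F: "finite F" "F \<subseteq> freqs L"
  shows "(LINT x|cell_measure L. (norm (trig_sum F c x))\<^sup>2) = L ^ 3 * (\<Sum>k\<in>F. (norm (c k))\<^sup>2)"
proof -
  have int: "integrable (cell_measure L) (\<lambda>x. c j * cnj (c k) * (fourier_mode j x * cnj (fourier_mode k x)))" for j k
    by (rule integrable_cell_bounded[where B="norm (c j * cnj (c k))"]) (auto simp: norm_mult)
  have "complex_of_real (LINT x|cell_measure L. (norm (trig_sum F c x))\<^sup>2)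
      = (LINT x|cell_measure L. of_real ((norm (trig_sum F c x))\<^sup>2))"
    by (rule integral_complex_of_real[symmetric])
  also have "\<dots> = (LINT x|cell_measure L. (\<Sum>j\<in>F. \<Sum>k\<in>F. c j * cnj (c k) * (fourier_mode j x * cnj (fourier_mode k x))))"
    by (simp only: complex_norm_square cnj_sum sum_product complex_cnj_mult) (simp only: mult_ac)
  also have "\<dots> = (\<Sum>j\<in>F. \<Sum>k\<in>F. c j * cnj (c k) * (LINT x|cell_measure L. fourier_mode j x * cnj (fourier_mode k x)))"
    by (simp add: int Bochner_Integration.integral_sum Bochner_Integration.integrable_sum)
  also have "\<dots> = (\<Sum>j\<in>F. \<Sum>k\<in>F. c j * cnj (c k) * (if j = k then of_real (L ^ 3) else 0))"
    using F by (intro sum.cong refl) (auto simp: fourier_mode_orthogonal[OF L] subsetD[OF F(2)])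
  also have "\<dots> = (\<Sum>j\<in>F. of_real (L ^ 3 * (norm (c j))\<^sup>2))"
    using F(1) by (intro sum.cong refl)
      (simp add: if_distrib sum.delta cong: if_cong, simp add: complex_norm_square flip: of_real_power)
  also have "\<dots> = of_real (L ^ 3 * (\<Sum>k\<in>F. (norm (c k))\<^sup>2))"
    by (simp add: sum_distrib_left)
  finally show ?thesis using of_real_eq_iff by blast
qed

text \<open>The scalar version of \<^const>\<open>fourier_coeff\<close>, written over the finite measure on which the
  modes are orthogonal.\<close>

definition mode_coeff :: "real \<Rightarrow> (real^3 \<Rightarrow> real) \<Rightarrow> real^3 \<Rightarrow> complex" where
  "mode_coeff L f k = (LINT x|cell_measure L. of_real (f x) * cnj (fourier_mode k x)) / of_real (L ^ 3)"

text \<open>The Fourier partial sum over \<open>F\<close> is the orthogonal projection onto the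
  trigonometric polynomials with frequencies in \<open>F\<close>, hence the best approximation among them.\<close>

lemma partial_sum_best_approximation:
  assumes L: "L > 0" and F: "finite F" "F \<subseteq> freqs L"
    and [measurable]: "f \<in> borel_measurable borel"
    and f2: "integrable (cell_measure L) (\<lambda>x. (f x)\<^sup>2)"
  shows "(LINT x|cell_measure L. (norm (of_real (f x) - trig_sum F (mode_coeff L f) x))\<^sup>2)
       \<le> (LINT x|cell_measure L. (norm (of_real (f x) - trig_sum F c x))\<^sup>2)"
proof -
  interpret finite_measure "cell_measure L" by (rule finite_measure_cell)
  let ?M = "cell_measure L"
  have fm[measurable]: "f \<in> borel_measurable ?M" by (rule cell_measure_borel) simp
  have em[measurable]: "fourier_mode k \<in> borel_measurable ?M" for k by (rule cell_measure_borel) simp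
  have fi: "integrable ?M f"
    using f2 by (rule square_integrable_imp_integrable[OF fm])
  have fe: "integrable ?M (\<lambda>x. of_real (f x) * g x)" if "g \<in> borel_measurable borel" "\<And>x. norm (g x) \<le> B" for g :: "_ \<Rightarrow> complex" and B
  proof (rule Bochner_Integration.integrable_bound[where f="\<lambda>x. B * f x"])
    show "AE x in ?M. norm (complex_of_real (f x) * g x) \<le> norm (B * f x)"
    proof (intro AE_I2)
      fix x
      have "norm (g x) \<le> \<bar>B\<bar>" using that(2)[of x] by linarith
      from mult_right_mono[OF this, of "\<bar>f x\<bar>"]
      show "norm (complex_of_real (f x) * g x) \<le> norm (B * f x)"
        by (simp add: norm_mult abs_mult mult.commute)
    qed
    show "(\<lambda>x. complex_of_real (f x) * g x) \<in> borel_measurable ?M"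
      using cell_measure_borel[OF that(1), of L] by measurable
  qed (use fi in simp)
  define a where "a = mode_coeff L f"
  define d where "d k = a k - c k" for k
  define g where "g x = of_real (f x) - trig_sum F a x" for x
  define h where "h x = trig_sum F d x" for x
  have tm[measurable]: "trig_sum F c \<in> borel_measurable borel" for c by measurable
  have gh: "of_real (f x) - trig_sum F c x = g x + h x" for x
    by (simp add: g_def h_def d_def left_diff_distrib sum_subtractf)
  have orth1: "(LINT x|?M. g x * cnj (fourier_mode k x)) = 0" if k: "k \<in> F" for k
  proof -
    have "(LINT x|?M. g x * cnj (fourier_mode k x))
       = (LINT x|?M. of_real (f x) * cnj (fourier_mode k x) - (\<Sum>j\<in>F. a j * (fourier_mode j x * cnj (fourier_mode k x))))"
      by (simp add: g_def left_diff_distrib sum_distrib_right mult.assoc)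
    also have "\<dots> = (LINT x|?M. of_real (f x) * cnj (fourier_mode k x))
        - (\<Sum>j\<in>F. a j * (LINT x|?M. (fourier_mode j x * cnj (fourier_mode k x))))"
    proof -
      have i1: "integrable ?M (\<lambda>x. of_real (f x) * cnj (fourier_mode k x))"
        by (rule fe[where B=1]) auto
      have i2: "integrable ?M (\<lambda>x. a j * (fourier_mode j x * cnj (fourier_mode k x)))" for j
        by (intro Bochner_Integration.integrable_mult_right integrable_cell_bounded[where B=1]) (auto simp: norm_mult)
      have "(LINT x|?M. (\<Sum>j\<in>F. a j * (fourier_mode j x * cnj (fourier_mode k x))))
          = (\<Sum>j\<in>F. (LINT x|?M. a j * (fourier_mode j x * cnj (fourier_mode k x))))"
        by (rule Bochner_Integration.integral_sum) (rule i2)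
      then show ?thesis
        by (subst Bochner_Integration.integral_diff[OF i1 Bochner_Integration.integrable_sum[OF i2]]) simp
    qed
    also have "(\<Sum>j\<in>F. a j * (LINT x|?M. (fourier_mode j x * cnj (fourier_mode k x))))
        = (\<Sum>j\<in>F. if j = k then a j * of_real (L ^ 3) else 0)"
      using F k by (intro sum.cong refl) (auto simp: fourier_mode_orthogonal[OF L] subsetD[OF F(2)])
    also have "\<dots> = a k * of_real (L ^ 3)" using F k by simp
    finally show ?thesis using L by (simp add: a_def mode_coeff_def)
  qed
  have gi: "integrable ?M (\<lambda>x. g x * cnj (fourier_mode k x))" for k
    unfolding g_def left_diff_distrib
    by (intro Bochner_Integration.integrable_diff fe[where B=1] integrable_cell_bounded[where B="(\<Sum>k\<in>F. norm (a k))"])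
       (use norm_trig_sum_le in \<open>auto simp: norm_mult\<close>)
  have gch: "g x * cnj (h x) = (\<Sum>k\<in>F. cnj (d k) * (g x * cnj (fourier_mode k x)))" for x
    by (simp add: h_def sum_distrib_left mult_ac)
  have ghi: "integrable ?M (\<lambda>x. g x * cnj (h x))"
    unfolding gch by (intro Bochner_Integration.integrable_sum Bochner_Integration.integrable_mult_right gi)
  have orth: "(LINT x|?M. g x * cnj (h x)) = 0"
    unfolding gch by (simp add: gi Bochner_Integration.integral_sum orth1)
  have g2: "integrable ?M (\<lambda>x. (norm (g x))\<^sup>2)"
  proof (rule Bochner_Integration.integrable_bound[where f="\<lambda>x. 2 * (f x)\<^sup>2 + 2 * (\<Sum>k\<in>F. norm (a k))\<^sup>2"])
    show "AE x in ?M. norm ((norm (g x))\<^sup>2) \<le> norm (2 * (f x)\<^sup>2 + 2 * (\<Sum>k\<in>F. norm (a k))\<^sup>2)"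
    proof (intro AE_I2)
      fix x
      have "norm (g x) \<le> \<bar>f x\<bar> + (\<Sum>k\<in>F. norm (a k))"
        unfolding g_def using norm_trig_sum_le[where c=a and F=F and x=x] norm_triangle_ineq4[of "of_real (f x)" "trig_sum F a x"] by simp
      then have "(norm (g x))\<^sup>2 \<le> (\<bar>f x\<bar> + (\<Sum>k\<in>F. norm (a k)))\<^sup>2" by (rule power_mono) simp
      also have "\<dots> \<le> 2 * (f x)\<^sup>2 + 2 * (\<Sum>k\<in>F. norm (a k))\<^sup>2"
        using sum_squares_bound[of "\<bar>f x\<bar>" "(\<Sum>k\<in>F. norm (a k))"] by (simp add: power2_sum)
      finally show "norm ((norm (g x))\<^sup>2) \<le> norm (2 * (f x)\<^sup>2 + 2 * (\<Sum>k\<in>F. norm (a k))\<^sup>2)" by simp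
    qed
    show "(\<lambda>x. (norm (g x))\<^sup>2) \<in> borel_measurable ?M"
      unfolding g_def by measurable
  qed (use f2 in simp)
  have h2: "integrable ?M (\<lambda>x. (norm (h x))\<^sup>2)"
    unfolding h_def using norm_trig_sum_le[where c=d and F=F]
    by (intro integrable_cell_bounded[where B="(\<Sum>k\<in>F. norm (d k))\<^sup>2"]) (auto intro!: power_mono)
  have exp: "(norm (g x + h x))\<^sup>2 = (norm (g x))\<^sup>2 + (norm (h x))\<^sup>2 + 2 * Re (g x * cnj (h x))" for x
    unfolding cmod_power2 by (simp add: power2_eq_square algebra_simps)
  have "(LINT x|?M. (norm (g x + h x))\<^sup>2)
      = (LINT x|?M. (norm (g x))\<^sup>2) + (LINT x|?M. (norm (h x))\<^sup>2) + 2 * Re (LINT x|?M. g x * cnj (h x))"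
  proof -
    have r: "integrable ?M (\<lambda>x. 2 * Re (g x * cnj (h x)))"
      using ghi by (intro Bochner_Integration.integrable_mult_right integrable_Re)
    have "(LINT x|?M. 2 * Re (g x * cnj (h x))) = 2 * Re (LINT x|?M. g x * cnj (h x))"
      using integral_Re[OF ghi] by (simp only: Bochner_Integration.integral_mult_right_zero)
    then show ?thesis unfolding exp
      by (simp only: Bochner_Integration.integral_add[OF Bochner_Integration.integrable_add[OF g2 h2] r]
          Bochner_Integration.integral_add[OF g2 h2])
  qed
  also have "\<dots> \<ge> (LINT x|?M. (norm (g x))\<^sup>2)"
    by (simp add: orth)
  finally show ?thesis by (simp only: gh) (simp only: g_def a_def)
qed

section \<open>Density of trigonometric polynomials\<close>

text \<open>Sums of modes, in a form that lends itself to rule induction for the closure under products.\<close>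

inductive trig_poly :: "real \<Rightarrow> (real^3 \<Rightarrow> complex) \<Rightarrow> bool" for L where
  mode: "k \<in> freqs L \<Longrightarrow> trig_poly L (\<lambda>x. c * fourier_mode k x)"
| add: "trig_poly L f \<Longrightarrow> trig_poly L g \<Longrightarrow> trig_poly L (\<lambda>x. f x + g x)"

lemma trig_poly_const: "trig_poly L (\<lambda>x. c)"
  using trig_poly.mode[OF freqs_closed(1), of L c] by simp

lemma trig_poly_sum:
  assumes "finite A" "\<And>a. a \<in> A \<Longrightarrow> trig_poly L (f a)"
  shows "trig_poly L (\<lambda>x. \<Sum>a\<in>A. f a x)"
  using assms
proof induction
  case empty
  then show ?case using trig_poly_const[of L 0] by simp
next
  case (insert a A)
  then show ?case using trig_poly.add[of L "f a" "\<lambda>x. \<Sum>a\<in>A. f a x"] by simp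
qed

lemma trig_poly_mode_mult:
  assumes g: "trig_poly L g" and k: "k \<in> freqs L"
  shows "trig_poly L (\<lambda>x. c * fourier_mode k x * g x)"
  using g
proof induction
  case (mode j d)
  have "(\<lambda>x. c * fourier_mode k x * (d * fourier_mode j x)) = (\<lambda>x. (c * d) * fourier_mode (k + j) x)"
    by (simp add: fourier_mode_add_left mult_ac)
  then show ?case using trig_poly.mode[OF freqs_closed(2)[OF k mode]] by simp
next
  case (add f g)
  then show ?case by (simp add: distrib_left trig_poly.add)
qed

lemma trig_poly_mult:
  assumes "trig_poly L f" and g: "trig_poly L g"
  shows "trig_poly L (\<lambda>x. f x * g x)"
  using assms(1)
proof induction
  case (mode k c)
  then show ?case using trig_poly_mode_mult[OF g] by simp
next
  case (add f h)
  then show ?case by (simp add: distrib_right trig_poly.add)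
qed

lemma trig_poly_eq_trig_sum:
  assumes "trig_poly L f"
  shows "\<exists>F c. finite F \<and> F \<subseteq> freqs L \<and> f = trig_sum F c"
  using assms
proof induction
  case (mode k c)
  then show ?case by (intro exI[of _ "{k}"] exI[of _ "\<lambda>_. c"]) auto
next
  case (add f g)
  then obtain F c G d where F: "finite F" "F \<subseteq> freqs L" "f = trig_sum F c"
    and G: "finite G" "G \<subseteq> freqs L" "g = trig_sum G d" by auto
  let ?e = "\<lambda>k. (if k \<in> F then c k else 0) + (if k \<in> G then d k else 0)"
  have "f x + g x = trig_sum (F \<union> G) ?e x" for x
  proof -
    have "trig_sum (F \<union> G) (\<lambda>k. if k \<in> F then c k else 0) x = f x"
      unfolding F(3) using F(1) G(1) by (intro sum.mono_neutral_cong_right) auto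
    moreover have "trig_sum (F \<union> G) (\<lambda>k. if k \<in> G then d k else 0) x = g x"
      unfolding G(3) using F(1) G(1) by (intro sum.mono_neutral_cong_right) auto
    ultimately show ?thesis by (simp add: distrib_right sum.distrib)
  qed
  then show ?case using F G by (intro exI[of _ "F \<union> G"] exI[of _ ?e]) auto
qed

text \<open>Trigonometric polynomials do not separate opposite faces of the closed cell, so
  Stone-Weierstrass cannot be applied there. On the torus embedded in \<open>\<complex>\<^sup>3\<close> the coordinate functions
  separate points, and their pull-backs under this map are trigonometric polynomials.\<close>

definition torus_map :: "real \<Rightarrow> real^3 \<Rightarrow> complex^3" where
  "torus_map L x = (\<chi> i. cis (2 * pi * x $ i / L))"

lemma torus_map_component:
  assumes "L > 0"
  shows "torus_map L x $ i = fourier_mode (axis i (1 / L)) x"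
  by (simp add: torus_map_def fourier_mode_def inner_axis' cis_conv_exp mult_ac)

lemma torus_coordinate_trig_poly:
  assumes L: "L > 0" and b: "b \<in> Basis"
  shows "trig_poly L (\<lambda>x. of_real (torus_map L x \<bullet> b))"
proof -
  obtain i u where iu: "b = axis i u" "u \<in> Basis" using b by (auto simp: Basis_vec_def)
  let ?k = "axis i (1 / L) :: real^3"
  have k: "?k \<in> freqs L" using L by (auto simp: freqs_def axis_def)
  have "of_real (torus_map L x \<bullet> b) =
     (if u = 1 then 1/2 * fourier_mode ?k x + 1/2 * fourier_mode (- ?k) x
      else (-\<i>/2) * fourier_mode ?k x + (\<i>/2) * fourier_mode (- ?k) x)" for x
  proof -
    have 1: "torus_map L x \<bullet> b = fourier_mode ?k x \<bullet> u"
      by (simp add: iu(1) inner_axis torus_map_component[OF L])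
    show ?thesis unfolding 1 fourier_mode_minus using iu(2)
      by (auto simp: Basis_complex_def inner_complex_def complex_eq_iff)
  qed
  then show ?thesis
    using trig_poly.add[OF trig_poly.mode[OF k] trig_poly.mode[OF freqs_closed(3)[OF k]]]
    by (cases "u = 1") (simp_all only: if_True if_False refl)
qed

lemma polynomial_on_torus_trig_poly:
  assumes L: "L > 0" and g: "real_polynomial_function g"
  shows "trig_poly L (\<lambda>x. of_real (g (torus_map L x)))"
  using g
proof induction
  case (linear f)
  then interpret bounded_linear f .
  have eq: "of_real (f w) = (\<Sum>b\<in>Basis. complex_of_real (f b) * of_real (w \<bullet> b))" for w
  proof -
    have "f w = f (\<Sum>b\<in>Basis. (w \<bullet> b) *\<^sub>R b)" by (simp add: euclidean_representation)
    also have "\<dots> = (\<Sum>b\<in>Basis. (w \<bullet> b) * f b)" by (simp add: sum scale)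
    finally show ?thesis by (simp add: mult.commute)
  qed
  then show ?case
    by (subst eq) (rule trig_poly_sum[OF finite_Basis trig_poly_mult[OF trig_poly_const torus_coordinate_trig_poly[OF L]]])
next
  case (const c)
  then show ?case by (rule trig_poly_const)
next
  case (add f g)
  then show ?case by (simp add: trig_poly.add)
next
  case (mult f g)
  then show ?case by (simp add: trig_poly_mult)
qed

text \<open>The torus map only identifies points of the closed cell that lie on opposite faces, so a
  function vanishing on the boundary descends to a continuous function on the torus.\<close>

lemma uniform_trig_approximation:
  fixes h :: "real^3 \<Rightarrow> real"
  assumes L: "L > 0" and h: "continuous_on (cell L) h"
    and zero: "\<And>x. x \<in> cell L \<Longrightarrow> x \<notin> box 0 (\<chi> i. L) \<Longrightarrow> h x = 0" and e: "e > 0"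
  shows "\<exists>F c. finite F \<and> F \<subseteq> freqs L \<and> (\<forall>x\<in>cell L. norm (of_real (h x) - trig_sum F c x) \<le> e)"
proof -
  define p where "p = torus_map L"
  have pc: "continuous_on A p" for A
    unfolding p_def torus_map_def continuous_on_vec_lambda
    using L by (intro continuous_intros) auto
  have cc: "compact (cell L)" by (simp add: cell_def compact_cbox)
  have fibre: "h x = h y" if xy: "x \<in> cell L" "y \<in> cell L" "p x = p y" for x y
  proof -
    have comp: "x $ i = y $ i \<or> x $ i = 0 \<and> y $ i = L \<or> x $ i = L \<and> y $ i = 0" for i
    proof -
      have "cis (2 * pi * x $ i / L) = cis (2 * pi * y $ i / L)"
        using xy(3) by (simp add: p_def torus_map_def vec_eq_iff)
      then obtain n :: int where n: "2 * pi * x $ i / L = 2 * pi * y $ i / L + 2 * pi * n"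
        using sin_cos_eq_iff[of "2 * pi * x $ i / L" "2 * pi * y $ i / L"] by (auto simp: complex_eq_iff)
      then have "2 * pi * x $ i = 2 * pi * (y $ i + L * n)"
        using L by (simp add: field_simps)
      then have n': "x $ i = y $ i + L * n"
        by simp
      have b: "0 \<le> x $ i" "x $ i \<le> L" "0 \<le> y $ i" "y $ i \<le> L" using xy by (auto simp: mem_cell)
      then have "L * real_of_int n \<le> L * 1" "L * (- 1) \<le> L * real_of_int n" using n' by auto
      then have "real_of_int n \<le> 1" "- 1 \<le> real_of_int n"
        using L by (simp_all only: mult_le_cancel_left_pos)
      then have "n = 0 \<or> n = 1 \<or> n = -1" by linarith
      then show ?thesis using n' b by auto
    qed
    show ?thesis
    proof (cases "x = y")
      case False
      then obtain i where "x $ i \<noteq> y $ i" by (auto simp: vec_eq_iff)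
      then have "x \<notin> box 0 (\<chi> i. L)" "y \<notin> box 0 (\<chi> i. L)"
        using comp[of i] by (auto simp: mem_box_cart intro!: exI[of _ i])
      then show ?thesis using zero xy by simp
    qed simp
  qed
  define H where "H w = h (inv_into (cell L) p w)" for w
  have Hp: "H (p x) = h x" if x: "x \<in> cell L" for x
    unfolding H_def using x by (intro fibre) (auto intro: inv_into_into f_inv_into_f)
  have Hc: "continuous_on (p ` cell L) H"
    unfolding continuous_on_closed_vimage[OF compact_imp_closed[OF compact_continuous_image[OF pc cc]]]
  proof (intro allI impI)
    fix B :: "real set" assume B: "closed B"
    have "H -` B \<inter> p ` cell L = p ` (h -` B \<inter> cell L)"
      using Hp by (auto simp: image_iff)
    moreover have "closed (h -` B \<inter> cell L)"
      using h B cc by (metis compact_imp_closed continuous_on_closed_vimage)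
    then have "compact (h -` B \<inter> cell L)"
      using cc by (metis compact_Int_closed inf.left_idem inf_commute)
    ultimately show "closed (H -` B \<inter> p ` cell L)"
      by (simp add: compact_continuous_image[OF pc] compact_imp_closed)
  qed
  obtain g where g: "real_polynomial_function g" "\<And>w. w \<in> p ` cell L \<Longrightarrow> \<bar>H w - g w\<bar> < e"
    using Stone_Weierstrass_real_polynomial_function[OF compact_continuous_image[OF pc cc] Hc e] by blast
  from trig_poly_eq_trig_sum[OF polynomial_on_torus_trig_poly[OF L g(1)]]
  obtain F c where F: "finite F" "F \<subseteq> freqs L" "(\<lambda>x. of_real (g (torus_map L x))) = trig_sum F c"
    by blast
  have "norm (of_real (h x) - trig_sum F c x) \<le> e" if x: "x \<in> cell L" for x
  proof -
    have "trig_sum F c x = of_real (g (p x))" using fun_cong[OF F(3), of x] by (simp add: p_def)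
    then have "norm (of_real (h x) - trig_sum F c x) = \<bar>H (p x) - g (p x)\<bar>"
      by (simp only: Hp[OF x] of_real_diff[symmetric] norm_of_real)
    then show ?thesis using g(2)[of "p x"] x by simp
  qed
  then show ?thesis using F by blast
qed

lemma L2_triangle:
  fixes a b :: "'a \<Rightarrow> complex"
  assumes [measurable]: "a \<in> borel_measurable M" "b \<in> borel_measurable M"
    and a: "integrable M (\<lambda>x. (norm (a x))\<^sup>2)" and b: "integrable M (\<lambda>x. (norm (b x))\<^sup>2)"
  shows "integrable M (\<lambda>x. (norm (a x + b x))\<^sup>2)"
    "(LINT x|M. (norm (a x + b x))\<^sup>2) \<le> 2 * (LINT x|M. (norm (a x))\<^sup>2) + 2 * (LINT x|M. (norm (b x))\<^sup>2)"
proof -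
  have le: "(norm (a x + b x))\<^sup>2 \<le> 2 * (norm (a x))\<^sup>2 + 2 * (norm (b x))\<^sup>2" for x
  proof -
    have "(norm (a x + b x))\<^sup>2 \<le> (norm (a x) + norm (b x))\<^sup>2"
      by (intro power_mono norm_triangle_ineq) simp
    also have "\<dots> \<le> 2 * (norm (a x))\<^sup>2 + 2 * (norm (b x))\<^sup>2"
      using sum_squares_bound[of "norm (a x)" "norm (b x)"] by (simp add: power2_sum)
    finally show ?thesis .
  qed
  have i: "integrable M (\<lambda>x. 2 * (norm (a x))\<^sup>2 + 2 * (norm (b x))\<^sup>2)" using a b by simp
  show int: "integrable M (\<lambda>x. (norm (a x + b x))\<^sup>2)"
    by (rule Bochner_Integration.integrable_bound[OF i]) (use le in auto)
  show "(LINT x|M. (norm (a x + b x))\<^sup>2) \<le> 2 * (LINT x|M. (norm (a x))\<^sup>2) + 2 * (LINT x|M. (norm (b x))\<^sup>2)"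
    using integral_mono[OF int i le] a b by simp
qed

text \<open>A measurable function is an almost everywhere limit of continuous functions \<open>g n\<close>. Clamping
  them to \<open>[-B, B]\<close> makes dominated convergence applicable, and the factor
  \<open>min 1 (n dist(x, \<partial>))\<close> makes them vanish on the boundary of the cell, as the uniform
  approximation requires, without changing the limit inside.\<close>

lemma trig_dense_bounded:
  assumes L: "L > 0" and f[measurable]: "f \<in> borel_measurable borel" and B: "\<And>x. \<bar>f x\<bar> \<le> B" and e: "e > 0"
  shows "\<exists>F c. finite F \<and> F \<subseteq> freqs L \<and>
    (LINT x|cell_measure L. (norm (of_real (f x) - trig_sum F c x))\<^sup>2) \<le> e"
proof -
  interpret finite_measure "cell_measure L" by (rule finite_measure_cell)
  let ?M = "cell_measure L" and ?Q = "box 0 (\<chi> i. L) :: (real^3) set"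
  have "f measurable_on UNIV"
    by (subst measurable_on_iff_borel_measurable)
      (simp_all add: lebesgue_on_UNIV_eq measurable_completion)
  then obtain N g where N: "negligible N" and g: "\<And>n. continuous_on UNIV (g n)"
    and lim: "\<And>x. x \<notin> N \<Longrightarrow> (\<lambda>n. g n x) \<longlonglongrightarrow> f x"
    unfolding measurable_on_def by auto
  define h where "h n x = max (- B) (min B (g n x)) * min 1 (real n * infdist x (- ?Q))" for n :: nat and x
  have hc: "continuous_on UNIV (h n)" for n
    unfolding h_def by (intro continuous_intros g continuous_on_infdist)
  have hm[measurable]: "h n \<in> borel_measurable borel" for n
    by (intro borel_measurable_continuous_onI hc)
  have B0: "B \<ge> 0" using B[of 0] by linarith
  have hB: "\<bar>h n x\<bar> \<le> B" for n x
  proof -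
    have 1: "\<bar>max (- B) (min B (g n x))\<bar> \<le> B" using B0 by auto
    have 2: "\<bar>min 1 (real n * infdist x (- ?Q))\<bar> \<le> 1" using infdist_nonneg[of x "- ?Q"] by auto
    show ?thesis unfolding h_def abs_mult using mult_mono[OF 1 2 B0] by simp
  qed
  have hz: "h n x = 0" if "x \<notin> ?Q" for n x
    using that by (simp add: h_def infdist_zero)
  have hlim: "(\<lambda>n. h n x) \<longlonglongrightarrow> f x" if x: "x \<notin> N" "x \<in> ?Q" for x
  proof -
    have "(0::real^3) \<notin> ?Q" by (auto simp: mem_box_cart)
    then have "infdist x (- ?Q) > 0" using x
      by (intro infdist_pos_not_in_closed) auto
    then have "LIM n sequentially. real n * infdist x (- ?Q) :> at_top"
      by (intro filterlim_at_top_mult_tendsto_pos[OF tendsto_const] filterlim_real_sequentially)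
         (simp_all add: mult.commute)
    then have "eventually (\<lambda>n. real n * infdist x (- ?Q) \<ge> 1) sequentially"
      by (simp add: filterlim_at_top)
    then have ev: "eventually (\<lambda>n. max (- B) (min B (g n x)) = h n x) sequentially"
      by eventually_elim (simp add: h_def)
    have "(\<lambda>n. max (- B) (min B (g n x))) \<longlonglongrightarrow> max (- B) (min B (f x))"
      by (intro tendsto_intros lim x)
    moreover have "max (- B) (min B (f x)) = f x" using B[of x] by auto
    ultimately show ?thesis using tendsto_cong[OF ev] by simp
  qed
  have "AE x in lebesgue. x \<notin> N"
    using N unfolding negligible_iff_null_sets by (rule AE_not_in)
  then have AEN: "AE x in lborel. x \<notin> N" by (simp add: AE_completion_iff)
  have AE: "AE x in ?M. (\<lambda>n. (f x - h n x)\<^sup>2) \<longlonglongrightarrow> 0"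
  proof (subst AE_restrict_space_iff)
    show "cell L \<inter> space lborel \<in> sets lborel" by simp
    show "AE x in lborel. x \<in> cell L \<longrightarrow> (\<lambda>n. (f x - h n x)\<^sup>2) \<longlonglongrightarrow> 0"
      using AEN cell_AE_box[of L]
    proof eventually_elim
      case (elim x)
      show ?case
      proof
        assume "x \<in> cell L"
        then have "(\<lambda>n. (f x - h n x)\<^sup>2) \<longlonglongrightarrow> (f x - f x)\<^sup>2"
          using elim by (intro tendsto_intros hlim) auto
        then show "(\<lambda>n. (f x - h n x)\<^sup>2) \<longlonglongrightarrow> 0" by simp
      qed
    qed
  qed
  have fhB: "norm ((f x - h n x)\<^sup>2) \<le> (2 * B)\<^sup>2" for n x
  proof -
    have "\<bar>f x - h n x\<bar> \<le> \<bar>2 * B\<bar>" using B[of x] hB[of n x] by linarith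
    then show ?thesis by (simp add: abs_le_square_iff)
  qed
  have "(\<lambda>n. LINT x|?M. (f x - h n x)\<^sup>2) \<longlonglongrightarrow> (LINT x|?M. 0)"
    by (rule integral_dominated_convergence[where w="\<lambda>_. (2 * B)\<^sup>2"])
       (use AE fhB in \<open>auto intro!: cell_measure_borel\<close>)
  then have "(\<lambda>n. LINT x|?M. (f x - h n x)\<^sup>2) \<longlonglongrightarrow> 0" by simp
  then have "eventually (\<lambda>n. (LINT x|?M. (f x - h n x)\<^sup>2) < e / 4) sequentially"
    using e by (intro order_tendstoD(2)) auto
  then obtain n where n: "(LINT x|?M. (f x - h n x)\<^sup>2) < e / 4"
    by (auto simp: eventually_sequentially)
  \<comment> \<open>\<open>L ^ 3\<close> is the measure of the cell, so a uniform error \<open>d\<close> contributes \<open>e / 4\<close> to the integral.\<close>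
  define d where "d = sqrt (e / (4 * L ^ 3))"
  have d: "d > 0" "d\<^sup>2 * L ^ 3 = e / 4" using e L by (auto simp: d_def)
  obtain F c where F: "finite F" "F \<subseteq> freqs L" "\<And>x. x \<in> cell L \<Longrightarrow> norm (of_real (h n x) - trig_sum F c x) \<le> d"
  proof -
    have "\<exists>F c. finite F \<and> F \<subseteq> freqs L \<and> (\<forall>x\<in>cell L. norm (of_real (h n x) - trig_sum F c x) \<le> d)"
      by (rule uniform_trig_approximation[OF L continuous_on_subset[OF hc[of n] subset_UNIV] _ d(1)]) (rule hz)
    then show ?thesis using that by blast
  qed
  have i1: "integrable ?M (\<lambda>x. (norm (complex_of_real (f x - h n x)))\<^sup>2)"
    unfolding norm_of_real power2_abs
    using fhB by (intro integrable_cell_bounded[where B="(2*B)\<^sup>2"]) auto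
  have i2: "integrable ?M (\<lambda>x. (norm (of_real (h n x) - trig_sum F c x))\<^sup>2)"
  proof (rule integrable_cell_bounded[where B="(B + (\<Sum>k\<in>F. norm (c k)))\<^sup>2"])
    fix x
    have "norm (of_real (h n x) - trig_sum F c x) \<le> B + (\<Sum>k\<in>F. norm (c k))"
      using norm_trig_sum_le[where c=c and F=F and x=x] hB[of n x]
        norm_triangle_ineq4[of "of_real (h n x)" "trig_sum F c x"] by simp
    then show "norm ((norm (of_real (h n x) - trig_sum F c x))\<^sup>2) \<le> (B + (\<Sum>k\<in>F. norm (c k)))\<^sup>2"
      by (simp add: power_mono)
  qed measurable
  have "(LINT x|?M. (norm (of_real (h n x) - trig_sum F c x))\<^sup>2) \<le> (LINT x|?M. d\<^sup>2)"
    using F(3) by (intro integral_mono_AE i2) (auto simp: space_restrict_space intro!: AE_I2 power_mono)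
  also have "\<dots> = e / 4" using d measure_cell[OF L] by (simp add: mult.commute)
  finally have le2: "(LINT x|?M. (norm (of_real (h n x) - trig_sum F c x))\<^sup>2) \<le> e / 4" .
  have "(LINT x|?M. (norm (complex_of_real (f x - h n x) + (of_real (h n x) - trig_sum F c x)))\<^sup>2)
     \<le> 2 * (LINT x|?M. (norm (complex_of_real (f x - h n x)))\<^sup>2) + 2 * (LINT x|?M. (norm (of_real (h n x) - trig_sum F c x))\<^sup>2)"
    by (intro L2_triangle(2) i1 i2; intro cell_measure_borel; measurable)
  also have "\<dots> \<le> e" using n le2 unfolding norm_of_real power2_abs by linarith
  finally show ?thesis using F by auto
qed

lemma trig_dense:
  assumes L: "L > 0" and f[measurable]: "f \<in> borel_measurable borel"
    and f2: "integrable (cell_measure L) (\<lambda>x. (f x)\<^sup>2)" and e: "e > 0"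
  shows "\<exists>F c. finite F \<and> F \<subseteq> freqs L \<and>
    (LINT x|cell_measure L. (norm (of_real (f x) - trig_sum F c x))\<^sup>2) \<le> e"
proof -
  let ?M = "cell_measure L"
  define g where "g n x = max (- real n) (min (real n) (f x))" for n x
  have [measurable]: "g n \<in> borel_measurable borel" for n unfolding g_def by measurable
  have gle: "\<bar>f x - g n x\<bar> \<le> \<bar>f x\<bar>" for n x unfolding g_def by auto
  then have gle2: "(f x - g n x)\<^sup>2 \<le> (f x)\<^sup>2" for n x by (simp add: abs_le_square_iff)
  have lim: "(\<lambda>n. (f x - g n x)\<^sup>2) \<longlonglongrightarrow> 0" for x
  proof (rule tendsto_eventually)
    obtain m where "\<bar>f x\<bar> \<le> real m" using real_arch_simple by blast
    then show "eventually (\<lambda>n. (f x - g n x)\<^sup>2 = 0) sequentially"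
      by (intro eventually_sequentiallyI[of m]) (auto simp: g_def)
  qed
  have "(\<lambda>n. LINT x|?M. (f x - g n x)\<^sup>2) \<longlonglongrightarrow> (LINT x|?M. 0)"
    by (rule integral_dominated_convergence[where w="\<lambda>x. (f x)\<^sup>2"])
       (use f2 lim gle2 in \<open>auto intro!: cell_measure_borel\<close>)
  then have "(\<lambda>n. LINT x|?M. (f x - g n x)\<^sup>2) \<longlonglongrightarrow> 0" by simp
  then have "eventually (\<lambda>n. (LINT x|?M. (f x - g n x)\<^sup>2) < e / 4) sequentially"
    using e by (intro order_tendstoD(2)) auto
  then obtain n where n: "(LINT x|?M. (f x - g n x)\<^sup>2) < e / 4"
    by (auto simp: eventually_sequentially)
  have gn: "\<bar>g n x\<bar> \<le> real n" for x by (auto simp: g_def)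
  obtain F c where F: "finite F" "F \<subseteq> freqs L" "(LINT x|?M. (norm (of_real (g n x) - trig_sum F c x))\<^sup>2) \<le> e / 4"
    using trig_dense_bounded[OF L \<open>g n \<in> borel_measurable borel\<close> gn, where e="e / 4"] e by auto
  have i1: "integrable ?M (\<lambda>x. (norm (complex_of_real (f x - g n x)))\<^sup>2)"
    unfolding norm_of_real power2_abs
    using gle2 by (intro Bochner_Integration.integrable_bound[OF f2] cell_measure_borel) auto
  have i2: "integrable ?M (\<lambda>x. (norm (of_real (g n x) - trig_sum F c x))\<^sup>2)"
  proof (rule integrable_cell_bounded[where B="(real n + (\<Sum>k\<in>F. norm (c k)))\<^sup>2"])
    fix x
    have "norm (of_real (g n x) - trig_sum F c x) \<le> real n + (\<Sum>k\<in>F. norm (c k))"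
      using norm_trig_sum_le[where c=c and F=F and x=x] gn[of x]
        norm_triangle_ineq4[of "of_real (g n x)" "trig_sum F c x"] by simp
    then show "norm ((norm (of_real (g n x) - trig_sum F c x))\<^sup>2) \<le> (real n + (\<Sum>k\<in>F. norm (c k)))\<^sup>2"
      by (simp add: power_mono)
  qed measurable
  have "(LINT x|?M. (norm (complex_of_real (f x - g n x) + (of_real (g n x) - trig_sum F c x)))\<^sup>2)
     \<le> 2 * (LINT x|?M. (norm (complex_of_real (f x - g n x)))\<^sup>2) + 2 * (LINT x|?M. (norm (of_real (g n x) - trig_sum F c x))\<^sup>2)"
    by (intro L2_triangle(2) i1 i2; intro cell_measure_borel; measurable)
  also have "\<dots> \<le> e" using n F(3) unfolding norm_of_real power2_abs by linarith
  finally show ?thesis using F by auto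
qed

section \<open>Increments and Littlewood-Paley blocks of a fixed time slice\<close>

text \<open>Write \<open>f = P + g\<close> with a Fourier partial sum \<open>P\<close> and \<open>g\<close> small in \<open>L\<^sup>2\<close>. Parseval evaluates
  the increment of \<open>P\<close>, and translation invariance bounds the increment of \<open>g\<close> by \<open>g\<close> itself.
  The factor 2 is the price of splitting the square.\<close>

lemma increment_le_modes:
  assumes L: "L > 0" and f[measurable]: "f \<in> borel_measurable borel" and per: "periodic L f"
    and f2: "integrable (cell_measure L) (\<lambda>x. (f x)\<^sup>2)" and e: "e > 0"
  shows "\<exists>F. finite F \<and> F \<subseteq> freqs L \<and>
    (\<integral>\<^sup>+x. ennreal ((f (x + y) - f x)\<^sup>2) \<partial>cell_measure L)
      \<le> ennreal (2 * (L ^ 3 * (\<Sum>k\<in>F. (norm (mode_coeff L f k * (fourier_mode k y - 1)))\<^sup>2)) + e)"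
proof -
  let ?M = "cell_measure L"
  \<comment> \<open>The error \<open>g\<close> enters below twice, each time with the factor 4.\<close>
  obtain F c where F: "finite F" "F \<subseteq> freqs L"
    and le: "(LINT x|?M. (norm (of_real (f x) - trig_sum F c x))\<^sup>2) \<le> e / 8"
    using trig_dense[OF L f f2, of "e / 8"] e by auto
  define P where "P = trig_sum F (mode_coeff L f)"
  define g where "g x = of_real (f x) - P x" for x
  have Pm[measurable]: "P \<in> borel_measurable borel" unfolding P_def by measurable
  have gm[measurable]: "g \<in> borel_measurable borel" unfolding g_def by measurable
  have "integrable ?M (\<lambda>x. (norm (of_real (f x) + (- P x)))\<^sup>2)"
  proof (rule L2_triangle(1))
    show "integrable ?M (\<lambda>x. (norm (complex_of_real (f x)))\<^sup>2)" using f2 by simp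
    show "integrable ?M (\<lambda>x. (norm (- P x))\<^sup>2)"
      using norm_trig_sum_le[where c="mode_coeff L f" and F=F]
      by (intro integrable_cell_bounded[where B="(\<Sum>k\<in>F. norm (mode_coeff L f k))\<^sup>2"]) (auto simp: P_def intro!: power_mono)
  qed (intro cell_measure_borel; measurable)+
  then have gi: "integrable ?M (\<lambda>x. (norm (g x))\<^sup>2)" by (simp add: g_def)
  have "(LINT x|?M. (norm (g x))\<^sup>2) \<le> e / 8"
    using partial_sum_best_approximation[OF L F f f2, of c] le by (simp add: g_def P_def)
  then have g2: "(\<integral>\<^sup>+x. ennreal ((norm (g x))\<^sup>2) \<partial>?M) \<le> ennreal (e / 8)"
    by (subst nn_integral_eq_integral[OF gi]) (auto intro: ennreal_leI)
  have "periodic L P"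
    using fourier_mode_periodic F(2) by (auto simp: P_def periodic_def intro!: sum.cong)
  then have "periodic L (\<lambda>x. ennreal ((norm (g x))\<^sup>2))"
    using per by (simp add: periodic_def g_def)
  from nn_integral_cell_translate[OF L this, of y]
  have gy: "(\<integral>\<^sup>+x. ennreal ((norm (g (x + y)))\<^sup>2) \<partial>?M) \<le> ennreal (e / 8)"
    using g2 by simp
  define d where "d k = mode_coeff L f k * (fourier_mode k y - 1)" for k
  have dP: "P (x + y) - P x = trig_sum F d x" for x
    by (simp add: P_def d_def fourier_mode_add_right sum_subtractf[symmetric] algebra_simps)
  have dPi: "integrable ?M (\<lambda>x. (norm (trig_sum F d x))\<^sup>2)"
    using norm_trig_sum_le[where c=d and F=F]
    by (intro integrable_cell_bounded[where B="(\<Sum>k\<in>F. norm (d k))\<^sup>2"]) (auto intro!: power_mono)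
  have dP2: "(\<integral>\<^sup>+x. ennreal ((norm (trig_sum F d x))\<^sup>2) \<partial>?M) = ennreal (L ^ 3 * (\<Sum>k\<in>F. (norm (d k))\<^sup>2))"
    using nn_integral_eq_integral[OF dPi] parseval_trig_sum[OF L F, of d] by simp
  have pw: "ennreal ((f (x + y) - f x)\<^sup>2)
      \<le> 2 * ennreal ((norm (trig_sum F d x))\<^sup>2) + (4 * ennreal ((norm (g (x + y)))\<^sup>2) + 4 * ennreal ((norm (g x))\<^sup>2))" for x
  proof -
    have sq: "(s + t)\<^sup>2 \<le> 2 * s\<^sup>2 + 2 * t\<^sup>2" for s t :: real
      using sum_squares_bound[of s t] by (simp add: power2_sum)
    have "complex_of_real (f (x + y) - f x) = trig_sum F d x + (g (x + y) - g x)"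
      by (simp add: g_def dP[symmetric])
    then have "\<bar>f (x + y) - f x\<bar> = norm (trig_sum F d x + (g (x + y) - g x))"
      by (metis norm_of_real)
    also have "\<dots> \<le> norm (trig_sum F d x) + (norm (g (x + y)) + norm (g x))"
      by (rule order_trans[OF norm_triangle_ineq]) (simp add: norm_triangle_ineq4)
    finally have "(f (x + y) - f x)\<^sup>2 \<le> (norm (trig_sum F d x) + (norm (g (x + y)) + norm (g x)))\<^sup>2"
      by (simp add: abs_le_square_iff[symmetric])
    also have "\<dots> \<le> 2 * (norm (trig_sum F d x))\<^sup>2 + 2 * (norm (g (x + y)) + norm (g x))\<^sup>2" by (rule sq)
    also have "\<dots> \<le> 2 * (norm (trig_sum F d x))\<^sup>2 + (4 * (norm (g (x + y)))\<^sup>2 + 4 * (norm (g x))\<^sup>2)"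
      using sq[of "norm (g (x + y))" "norm (g x)"] by simp
    finally have "ennreal ((f (x + y) - f x)\<^sup>2) \<le> ennreal (2 * (norm (trig_sum F d x))\<^sup>2 + (4 * (norm (g (x + y)))\<^sup>2 + 4 * (norm (g x))\<^sup>2))"
      by (rule ennreal_leI)
    then show ?thesis by (simp add: ennreal_mult)
  qed
  have m: "(\<lambda>x. ennreal ((norm (trig_sum F d x))\<^sup>2)) \<in> borel_measurable ?M"
    "(\<lambda>x. ennreal ((norm (g (x + y)))\<^sup>2)) \<in> borel_measurable ?M"
    "(\<lambda>x. ennreal ((norm (g x))\<^sup>2)) \<in> borel_measurable ?M"
    by (intro cell_measure_borel; measurable)+
  have "(\<integral>\<^sup>+x. ennreal ((f (x + y) - f x)\<^sup>2) \<partial>?M)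
     \<le> (\<integral>\<^sup>+x. 2 * ennreal ((norm (trig_sum F d x))\<^sup>2) + (4 * ennreal ((norm (g (x + y)))\<^sup>2) + 4 * ennreal ((norm (g x))\<^sup>2)) \<partial>?M)"
    by (intro nn_integral_mono pw)
  also have "\<dots> = 2 * (\<integral>\<^sup>+x. ennreal ((norm (trig_sum F d x))\<^sup>2) \<partial>?M)
     + (4 * (\<integral>\<^sup>+x. ennreal ((norm (g (x + y)))\<^sup>2) \<partial>?M) + 4 * (\<integral>\<^sup>+x. ennreal ((norm (g x))\<^sup>2) \<partial>?M))"
    by (simp only: nn_integral_add nn_integral_cmult m borel_measurable_add borel_measurable_times_ennreal borel_measurable_const)
  also have "\<dots> \<le> 2 * ennreal (L ^ 3 * (\<Sum>k\<in>F. (norm (d k))\<^sup>2)) + (4 * ennreal (e / 8) + 4 * ennreal (e / 8))"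
    unfolding dP2 by (intro add_mono mult_left_mono g2 gy order_refl) auto
  also have "\<dots> = ennreal (2 * (L ^ 3 * (\<Sum>k\<in>F. (norm (d k))\<^sup>2)) + e)"
  proof -
    have "4 * ennreal (e / 8) + 4 * ennreal (e / 8) = ennreal (4 * (e / 8) + 4 * (e / 8))"
      using e by (simp only: ennreal_plus ennreal_mult) (simp add: ennreal_mult[symmetric] ennreal_plus[symmetric] del: ennreal_plus)
    moreover have "2 * ennreal (L ^ 3 * (\<Sum>k\<in>F. (norm (d k))\<^sup>2)) = ennreal (2 * (L ^ 3 * (\<Sum>k\<in>F. (norm (d k))\<^sup>2)))"
      using L by (simp add: ennreal_mult sum_nonneg)
    ultimately show ?thesis
      using e L by (simp add: ennreal_plus[symmetric] sum_nonneg del: ennreal_plus)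
  qed
  finally show ?thesis using F unfolding d_def by blast
qed

lemma lp_cutoff_zero:
  assumes "lp_cutoff chi" "1 \<le> norm \<xi>"
  shows "chi \<xi> = 0"
proof (rule ccontr)
  assume "chi \<xi> \<noteq> 0"
  then have "\<xi> \<in> closure {\<xi>. chi \<xi> \<noteq> 0}" by (intro subsetD[OF closure_subset]) simp
  moreover have "closure {\<xi>. chi \<xi> \<noteq> 0} \<subseteq> ball 0 1" using assms(1) unfolding lp_cutoff_def by (elim conjE)
  ultimately have "\<xi> \<in> ball 0 1" by (rule subsetD[rotated])
  then show False using assms(2) by simp
qed

lemma lp_cutoff_one: "lp_cutoff chi \<Longrightarrow> norm \<xi> \<le> 1 / 2 \<Longrightarrow> chi \<xi> = 1"
proof -
  assume "lp_cutoff chi" and le: "norm \<xi> \<le> 1 / 2"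
  then have "\<forall>\<xi>. norm \<xi> \<le> 1 / 2 \<longrightarrow> chi \<xi> = 1" unfolding lp_cutoff_def by (elim conjE)
  with le show "chi \<xi> = 1" by blast
qed

lemma lambda_pos: "L > 0 \<Longrightarrow> lambda L q > 0"
  by (simp add: lambda_def)

lemma lp_symbol_support:
  assumes chi: "lp_cutoff chi" and L: "L > 0" and nz: "lp_symbol chi L (int q) k \<noteq> 0"
  shows "norm k \<le> 2 * lambda L q"
proof (rule ccontr)
  assume "\<not> ?thesis"
  then have "2 * 2 ^ q < L * norm k" using L by (simp add: lambda_def field_simps)
  then have "1 \<le> norm (((L / 2 ^ q) *\<^sub>R k) /\<^sub>R 2)" "1 \<le> norm ((L / 2 ^ q) *\<^sub>R k)"
  proof -
    have 1: "2 ^ q \<le> L * norm k" using \<open>2 * 2 ^ q < L * norm k\<close> zero_less_power[of "2::real" q] by linarith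
    show "1 \<le> norm (((L / 2 ^ q) *\<^sub>R k) /\<^sub>R 2)" "1 \<le> norm ((L / 2 ^ q) *\<^sub>R k)"
      using L 1 \<open>2 * 2 ^ q < L * norm k\<close> by (simp_all add: field_simps)
  qed
  then show False using nz lp_cutoff_zero[OF chi] by (simp add: lp_symbol_def lp_phi_def)
qed

text \<open>Two consecutive symbols add up to one on each dyadic shell, so one of them is at least
  one half.\<close>

lemma lp_symbol_large:
  assumes chi: "lp_cutoff chi" and L: "L > 0" and k: "k \<in> freqs L" "k \<noteq> 0"
  shows "\<exists>q. 1 / 2 \<le> lp_symbol chi L (int q) k"
proof -
  define r where "r = L * norm k"
  have r1: "1 \<le> r"
  proof -
    obtain i where i: "k $ i \<noteq> 0" using k(2) by (auto simp: vec_eq_iff)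
    obtain n :: int where n: "L * k $ i = of_int n" using k(1) by (auto simp: freqs_def elim: Ints_cases)
    have "n \<noteq> 0" using n i L by auto
    then have "1 \<le> \<bar>real_of_int n\<bar>" by linarith
    also have "\<dots> = L * \<bar>k $ i\<bar>" using L by (simp add: n[symmetric] abs_mult)
    also have "\<dots> \<le> r" unfolding r_def using L component_le_norm_cart[of k i] by simp
    finally show ?thesis .
  qed
  obtain m where m: "r < 2 ^ m" using real_arch_pow[of 2 r] by auto
  define n where "n = (LEAST m. r < 2 ^ m)"
  have n1: "r < 2 ^ n" unfolding n_def by (rule LeastI[of _ m]) (rule m)
  then have "n \<noteq> 0" using r1 by (cases n) auto
  then obtain p where p: "n = Suc p" using not0_implies_Suc by blast
  have n2: "2 ^ p \<le> r"
    using not_less_Least[of p "\<lambda>m. r < 2 ^ m"] p unfolding n_def by auto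
  have z: "chi ((L / 2 ^ p) *\<^sub>R k) = 0"
    using n2 L by (intro lp_cutoff_zero[OF chi]) (simp add: r_def field_simps)
  have o: "chi ((L / 2 ^ Suc p) *\<^sub>R k /\<^sub>R 2) = 1"
    using n1 L by (intro lp_cutoff_one[OF chi]) (simp add: p r_def field_simps)
  have h: "((L / 2 ^ p) *\<^sub>R k) /\<^sub>R 2 = (L / 2 ^ Suc p) *\<^sub>R k" by simp
  have s: "lp_symbol chi L (int n) k = chi ((L / 2 ^ n) *\<^sub>R k /\<^sub>R 2) - chi ((L / 2 ^ n) *\<^sub>R k)" for n
    by (simp add: lp_symbol_def lp_phi_def del: scaleR_scaleR)
  have "lp_symbol chi L (int p) k + lp_symbol chi L (int (Suc p)) k = 1"
    by (simp only: s h z o)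
  then have "1 / 2 \<le> lp_symbol chi L (int p) k \<or> 1 / 2 \<le> lp_symbol chi L (int (Suc p)) k" by linarith
  then show ?thesis by blast
qed

lemma finite_freqs_ball:
  assumes L: "L > 0"
  shows "finite {k \<in> freqs L. norm k \<le> R}"
proof -
  let ?N = "{- \<lceil>L * R\<rceil>..\<lceil>L * R\<rceil>}"
  have "{k \<in> freqs L. norm k \<le> R} \<subseteq> (\<lambda>n::int^3. \<chi> i. of_int (n $ i) / L) ` {n. \<forall>i. n $ i \<in> ?N}"
  proof
    fix k assume k: "k \<in> {k \<in> freqs L. norm k \<le> R}"
    define n :: "int^3" where "n = (\<chi> i. \<lfloor>L * k $ i\<rfloor>)"
    have n: "of_int (n $ i) = L * k $ i" for i
      using k by (auto simp: n_def freqs_def elim!: Ints_cases dest!: spec[of _ i])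
    have "\<bar>L * k $ i\<bar> \<le> L * R" for i
      using component_le_norm_cart[of k i] k L by (simp add: abs_mult)
    then have "\<bar>real_of_int (n $ i)\<bar> \<le> L * R" for i by (simp add: n)
    then have "n $ i \<in> ?N" for i
      by (simp add: abs_le_iff) (metis ceiling_mono ceiling_of_int minus_le_iff of_int_minus)
    moreover have "k = (\<chi> i. of_int (n $ i) / L)" using L by (simp add: vec_eq_iff n)
    ultimately show "k \<in> (\<lambda>n::int^3. \<chi> i. of_int (n $ i) / L) ` {n. \<forall>i. n $ i \<in> ?N}" by blast
  qed
  moreover have "finite {n::int^3. \<forall>i. n $ i \<in> ?N}"
  proof -
    have "{n::int^3. \<forall>i. n $ i \<in> ?N} \<subseteq> (\<lambda>(a,b,c). vector [a,b,c]) ` (?N \<times> ?N \<times> ?N)"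
    proof
      fix n :: "int^3" assume "n \<in> {n. \<forall>i. n $ i \<in> ?N}"
      moreover have "n = vector [n $ 1, n $ 2, n $ 3]" by (simp add: vec_eq_iff forall_3)
      ultimately show "n \<in> (\<lambda>(a,b,c). vector [a,b,c]) ` (?N \<times> ?N \<times> ?N)"
        by (intro image_eqI[of _ _ "(n $ 1, n $ 2, n $ 3)"]) auto
    qed
    then show ?thesis by (rule finite_subset) simp
  qed
  ultimately show ?thesis using finite_subset by blast
qed

definition lp_support :: "(real^3 \<Rightarrow> real) \<Rightarrow> real \<Rightarrow> nat \<Rightarrow> (real^3) set" where
  "lp_support chi L q = {k \<in> freqs L. lp_symbol chi L (int q) k \<noteq> 0}"

lemma finite_lp_support: "lp_cutoff chi \<Longrightarrow> L > 0 \<Longrightarrow> finite (lp_support chi L q)"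
  by (rule finite_subset[OF _ finite_freqs_ball[of L "2 * lambda L q"]])
    (auto simp: lp_support_def lp_symbol_support)

text \<open>Chosen so that, for \<open>s = |y| / L\<close>, its product with the square of a symbol that is at least
  \<open>1 / 2\<close> at \<open>k\<close> dominates \<open>2 |e\<^sub>k(y) - 1|\<^sup>2\<close>: for such a level \<open>q\<close> one has \<open>|k| \<le> 2 \<lambda>\<^sub>q\<close>, whence
  \<open>|e\<^sub>k(y) - 1| \<le> 4 \<pi> min 1 (\<lambda>\<^sub>q |y|)\<close>, and \<open>128 = 2 \<cdot> 4 \<cdot> 4\<^sup>2\<close>.\<close>

definition increment_weight :: "real \<Rightarrow> nat \<Rightarrow> real" where
  "increment_weight s q = 128 * pi\<^sup>2 * min 1 ((2 ^ q * s)\<^sup>2)"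

lemma norm_fourier_mode_diff_le: "norm (fourier_mode k y - 1) \<le> min 2 (2 * pi * norm k * norm y)"
proof -
  have "norm (fourier_mode k y - 1) \<le> norm (fourier_mode k y) + norm (1::complex)" by (rule norm_triangle_ineq4)
  moreover have "norm (fourier_mode k y - 1) \<le> \<bar>2 * pi * (k \<bullet> y)\<bar>"
  proof -
    have "fourier_mode k y = exp (\<i> * of_real (2 * pi * (k \<bullet> y)))"
      by (simp add: fourier_mode_def mult_ac)
    then have "norm (fourier_mode k y - 1) = 2 * \<bar>sin (2 * pi * (k \<bullet> y) / 2)\<bar>"
      using dist_exp_i_1[of "2 * pi * (k \<bullet> y)"] by simp
    also have "\<dots> \<le> \<bar>2 * pi * (k \<bullet> y)\<bar>"
      using abs_sin_x_le_abs_x[of "2 * pi * (k \<bullet> y) / 2"] by simp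
    finally show ?thesis .
  qed
  moreover have "\<bar>2 * pi * (k \<bullet> y)\<bar> \<le> 2 * pi * norm k * norm y"
    using Cauchy_Schwarz_ineq2[of k y] by (simp add: abs_mult mult_ac)
  ultimately show ?thesis by auto
qed

lemma mode_le_increment_weight:
  assumes chi: "lp_cutoff chi" and L: "L > 0" and k: "k \<in> freqs L"
  shows "\<exists>q. 2 * (norm (fourier_mode k y - 1))\<^sup>2 \<le> increment_weight (norm y / L) q * (lp_symbol chi L (int q) k)\<^sup>2"
proof (cases "k = 0")
  case True
  then show ?thesis by (auto simp: increment_weight_def intro!: exI[of _ 0])
next
  case False
  obtain q where q: "1 / 2 \<le> lp_symbol chi L (int q) k" using lp_symbol_large[OF chi L k False] by blast
  define x where "x = 2 ^ q * (norm y / L)"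
  have x0: "x \<ge> 0" using L by (simp add: x_def)
  have "norm k \<le> 2 * lambda L q" using lp_symbol_support[OF chi L, of q k] q by auto
  then have "norm k * norm y \<le> 2 * x"
    using L mult_right_mono[of "norm k" "2 * lambda L q" "norm y"] by (simp add: x_def lambda_def mult_ac)
  then have "2 * pi * norm k * norm y \<le> 4 * pi * x" using mult_left_mono[of _ _ "2 * pi"] by (simp add: mult_ac)
  then have a: "norm (fourier_mode k y - 1) \<le> min 2 (4 * pi * x)"
    using norm_fourier_mode_diff_le[of k y] by linarith
  have "min 2 (4 * pi * x) \<le> 4 * pi * min 1 x"
  proof (cases "x \<le> 1")
    case False
    then have "min 1 x = 1" by simp
    then show ?thesis using pi_gt3 by (simp add: min.coboundedI1)
  qed simp
  with a have "norm (fourier_mode k y - 1) \<le> 4 * pi * min 1 x" by (rule order_trans)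
  then have "(norm (fourier_mode k y - 1))\<^sup>2 \<le> (4 * pi * min 1 x)\<^sup>2" by (rule power_mono) simp
  also have "\<dots> = 16 * pi\<^sup>2 * min 1 (x\<^sup>2)"
  proof -
    have "(min 1 x)\<^sup>2 = min 1 (x\<^sup>2)"
      using x0 power_le_one[of x 2] one_le_power[of x 2] by (cases "x \<le> 1") (auto simp: min_def)
    then show ?thesis by (simp add: power_mult_distrib)
  qed
  finally have 1: "2 * (norm (fourier_mode k y - 1))\<^sup>2 \<le> increment_weight (norm y / L) q * (1 / 4)"
    by (simp add: increment_weight_def x_def)
  have "(1 / 2)\<^sup>2 \<le> (lp_symbol chi L (int q) k)\<^sup>2" using q by (intro power_mono) auto
  then have "1 / 4 \<le> (lp_symbol chi L (int q) k)\<^sup>2" by (simp add: power2_eq_square)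
  then have "increment_weight (norm y / L) q * (1 / 4) \<le> increment_weight (norm y / L) q * (lp_symbol chi L (int q) k)\<^sup>2"
    by (intro mult_left_mono) (auto simp: increment_weight_def)
  with 1 show ?thesis using order_trans by blast
qed

text \<open>Each mode is charged to one level whose symbol is at least \<open>1 / 2\<close> there. The blocks are
  trigonometric polynomials, so their norms are given exactly by Parseval and collect all the
  charges.\<close>

lemma increment_le_blocks_scalar:
  assumes chi: "lp_cutoff chi" and L: "L > 0" and f[measurable]: "f \<in> borel_measurable borel"
    and per: "periodic L f" and f2: "integrable (cell_measure L) (\<lambda>x. (f x)\<^sup>2)"
  shows "(\<integral>\<^sup>+x. ennreal ((f (x + y) - f x)\<^sup>2) \<partial>cell_measure L)
    \<le> (\<Sum>q. ennreal (increment_weight (norm y / L) q) *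
         (\<integral>\<^sup>+x. ennreal ((norm (trig_sum (lp_support chi L q) (\<lambda>k. of_real (lp_symbol chi L (int q) k) * mode_coeff L f k) x))\<^sup>2) \<partial>cell_measure L))"
    (is "_ \<le> (\<Sum>q. ennreal (?W q) * ?I q)")
proof (rule ennreal_le_epsilon)
  fix e :: real assume e: "0 < e"
  let ?c = "mode_coeff L f" and ?s = "\<lambda>q k. lp_symbol chi L (int q) k"
  have W0: "?W q \<ge> 0" for q by (simp add: increment_weight_def)
  have fin: "finite (lp_support chi L q)" for q by (rule finite_lp_support[OF chi L])
  have sub: "lp_support chi L q \<subseteq> freqs L" for q by (auto simp: lp_support_def)
  have I: "?I q = ennreal (L ^ 3 * (\<Sum>k\<in>lp_support chi L q. (?s q k)\<^sup>2 * (norm (?c k))\<^sup>2))" for q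
  proof -
    let ?d = "\<lambda>k. of_real (?s q k) * ?c k"
    have i: "integrable (cell_measure L) (\<lambda>x. (norm (trig_sum (lp_support chi L q) ?d x))\<^sup>2)"
      using norm_trig_sum_le[where c="?d" and F="lp_support chi L q"]
      by (intro integrable_cell_bounded[where B="(\<Sum>k\<in>lp_support chi L q. norm (?d k))\<^sup>2"]) (auto intro!: power_mono)
    show ?thesis
      by (subst nn_integral_eq_integral[OF i])
        (simp_all add: parseval_trig_sum[OF L fin sub] norm_mult power_mult_distrib)
  qed
  obtain F where F: "finite F" "F \<subseteq> freqs L"
    and le: "(\<integral>\<^sup>+x. ennreal ((f (x + y) - f x)\<^sup>2) \<partial>cell_measure L)
      \<le> ennreal (2 * (L ^ 3 * (\<Sum>k\<in>F. (norm (?c k * (fourier_mode k y - 1)))\<^sup>2)) + e)"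
    using increment_le_modes[OF L f per f2 e] by blast
  let ?t = "\<lambda>k q. ennreal (?W q * (?s q k)\<^sup>2 * (norm (?c k))\<^sup>2 * L ^ 3)"
  have "ennreal (2 * (L ^ 3 * (\<Sum>k\<in>F. (norm (?c k * (fourier_mode k y - 1)))\<^sup>2)))
     = (\<Sum>k\<in>F. ennreal (2 * (norm (fourier_mode k y - 1))\<^sup>2 * (norm (?c k))\<^sup>2 * L ^ 3))"
    using L by (subst sum_ennreal) (auto simp: norm_mult power_mult_distrib sum_distrib_left mult_ac)
  also have "\<dots> \<le> (\<Sum>k\<in>F. \<Sum>q. ?t k q)"
  proof (rule sum_mono)
    fix k assume "k \<in> F"
    then obtain q where q: "2 * (norm (fourier_mode k y - 1))\<^sup>2 \<le> ?W q * (?s q k)\<^sup>2"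
      using mode_le_increment_weight[OF chi L] F(2) by blast
    have "ennreal (2 * (norm (fourier_mode k y - 1))\<^sup>2 * (norm (?c k))\<^sup>2 * L ^ 3) \<le> ?t k q"
      using L by (intro ennreal_leI mult_right_mono q) auto
    also have "\<dots> \<le> (\<Sum>q. ?t k q)"
      using sum_le_suminf[of "?t k" "{q}"] by simp
    finally show "ennreal (2 * (norm (fourier_mode k y - 1))\<^sup>2 * (norm (?c k))\<^sup>2 * L ^ 3) \<le> (\<Sum>q. ?t k q)" .
  qed
  also have "\<dots> = (\<Sum>q. \<Sum>k\<in>F. ?t k q)"
    by (rule suminf_sum[symmetric]) simp
  also have "\<dots> \<le> (\<Sum>q. ennreal (?W q) * ?I q)"
  proof (rule suminf_le)
    fix q
    have "(\<Sum>k\<in>F. ?t k q) = ennreal (?W q * (L ^ 3 * (\<Sum>k\<in>F. (?s q k)\<^sup>2 * (norm (?c k))\<^sup>2)))"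
      using L W0[of q] by (subst sum_ennreal) (auto simp: sum_distrib_left mult_ac)
    also have "\<dots> \<le> ennreal (?W q * (L ^ 3 * (\<Sum>k\<in>lp_support chi L q. (?s q k)\<^sup>2 * (norm (?c k))\<^sup>2)))"
    proof (intro ennreal_leI mult_left_mono W0)
      have "(\<Sum>k\<in>F. (?s q k)\<^sup>2 * (norm (?c k))\<^sup>2) = (\<Sum>k\<in>F \<inter> lp_support chi L q. (?s q k)\<^sup>2 * (norm (?c k))\<^sup>2)"
        using F by (intro sum.mono_neutral_right) (auto simp: lp_support_def)
      also have "\<dots> \<le> (\<Sum>k\<in>lp_support chi L q. (?s q k)\<^sup>2 * (norm (?c k))\<^sup>2)"
        using fin by (intro sum_mono2) auto
      finally show "(\<Sum>k\<in>F. (?s q k)\<^sup>2 * (norm (?c k))\<^sup>2) \<le> (\<Sum>k\<in>lp_support chi L q. (?s q k)\<^sup>2 * (norm (?c k))\<^sup>2)" .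
    qed (use L in simp)
    also have "\<dots> = ennreal (?W q) * ?I q"
      unfolding I using L W0 by (intro ennreal_mult mult_nonneg_nonneg sum_nonneg) auto
    finally show "(\<Sum>k\<in>F. ?t k q) \<le> ennreal (?W q) * ?I q" .
  qed auto
  finally have "ennreal (2 * (L ^ 3 * (\<Sum>k\<in>F. (norm (?c k * (fourier_mode k y - 1)))\<^sup>2))) + ennreal e
     \<le> (\<Sum>q. ennreal (?W q) * ?I q) + ennreal e" by (rule add_right_mono)
  then show "(\<integral>\<^sup>+x. ennreal ((f (x + y) - f x)\<^sup>2) \<partial>cell_measure L) \<le> (\<Sum>q. ennreal (?W q) * ?I q) + ennreal e"
    using le e L by (subst (asm) ennreal_plus[symmetric]) (auto intro!: sum_nonneg mult_nonneg_nonneg)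
qed

section \<open>Borel representatives and integration over space-time\<close>

lemma AE_lborel_translate:
  fixes c :: "'a::euclidean_space"
  assumes "AE x in lborel. P x"
  shows "AE x in lborel. P (x + c)"
proof -
  obtain N where N: "N \<in> null_sets lborel" "{x. \<not> P x} \<subseteq> N"
    using assms by (auto elim!: AE_E simp: null_sets_def)
  have Nb: "N \<in> sets borel" using N(1) by auto
  have "{x. x + c \<in> N} \<in> null_sets lborel"
  proof (rule null_setsI)
    show "emeasure lborel {x. x + c \<in> N} = 0"
      using emeasure_lborel_translate[OF Nb, of c] N(1) by auto
    have "(\<lambda>x. x + c) \<in> borel_measurable borel" by measurable
    from measurable_sets[OF this Nb] show "{x. x + c \<in> N} \<in> sets lborel" by (simp add: vimage_def)
  qed
  then show ?thesis by (rule AE_I') (use N(2) in auto)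
qed

lemma AE_lborel_fst:
  assumes "AE t in lborel. P t"
  shows "AE z in (lborel :: ('a::euclidean_space \<times> 'b::euclidean_space) measure). P (fst z)"
proof -
  obtain N where N: "N \<in> null_sets lborel" "{x. \<not> P x} \<subseteq> N"
    using assms by (auto elim!: AE_E simp: null_sets_def)
  have Nb[measurable]: "N \<in> sets borel" using N(1) by auto
  have "N \<times> (UNIV :: 'b set) \<in> null_sets (lborel \<Otimes>\<^sub>M lborel)"
  proof (rule null_setsI)
    show "emeasure (lborel \<Otimes>\<^sub>M lborel) (N \<times> (UNIV :: 'b set)) = 0"
      using N(1) by (subst lborel.emeasure_pair_measure_Times) auto
    show "N \<times> (UNIV :: 'b set) \<in> sets (lborel \<Otimes>\<^sub>M lborel)"
      using Nb by (intro pair_measureI) auto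
  qed
  then have "N \<times> (UNIV :: 'b set) \<in> null_sets lborel" by (simp add: lborel_prod)
  then show ?thesis by (rule AE_I') (use N(2) in auto)
qed

lemma AE_lborel_sections:
  assumes "AE z in (lborel :: ('a::euclidean_space \<times> 'b::euclidean_space) measure). P z"
  shows "AE t in lborel. AE x in lborel. P (t, x)"
  by (rule lborel_pair.AE_pair) (unfold lborel_prod, rule assms)

lemma closed_Omega: "closed (Omega T L)"
  unfolding Omega_def cell_def by (intro closed_Times) auto

lemma Omega_lebesgue: "Omega T L \<in> sets lebesgue"
  using borel_closed[OF closed_Omega] by (simp add: sets_completionI_sets)

text \<open>Lebesgue measure is complete, so \<open>f\<close> inherits measurability from \<open>g\<close>.\<close>

lemma lebesgue_measurable_AE_cong:
  fixes f g :: "'a::euclidean_space \<Rightarrow> 'b::topological_space"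
  assumes ae: "AE x in lborel. f x = g x" and g: "g \<in> borel_measurable borel"
  shows "f \<in> borel_measurable lebesgue"
proof (rule measurableI)
  fix A :: "'b set" assume A: "A \<in> sets borel"
  have "g -` A \<in> sets borel" using measurable_sets[OF g A] by simp
  then have gA: "g -` A \<in> sets lebesgue" by (simp add: sets_completionI_sets)
  show "f -` A \<inter> space lebesgue \<in> sets lebesgue"
  proof (rule completion.in_sets_AE[OF _ gA])
    have "AE x in lebesgue. f x = g x" using ae by (simp add: AE_completion_iff)
    then show "AE x in lebesgue. (x \<in> g -` A) = (x \<in> f -` A \<inter> space lebesgue)"
      by eventually_elim simp
  qed simp
qed simp

text \<open>Tonelli's theorem and the measurability in time of the Fourier coefficients call for a Borel
  function, while \<open>u\<close> is only Lebesgue measurable. The translates of a null set by the countable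
  period lattice still form a null set, so periodising a Borel representative of \<open>u\<close> on the cell
  changes \<open>u\<close> only on a null set.\<close>

lemma borel_periodic_representative:
  assumes L: "L > 0" and u: "L2_field T L u"
  obtains w where "w \<in> borel_measurable borel" "\<And>t. periodic L (\<lambda>x. w (t, x))"
    "AE z in lborel. fst z \<in> {0..T} \<longrightarrow> u z = w z"
proof -
  let ?Om = "Omega T L"
  note Om = Omega_lebesgue[of T L]
  define u0 where "u0 z = (if z \<in> ?Om then u z else 0)" for z
  have u0: "u0 \<in> borel_measurable lebesgue"
    unfolding u0_def using u Om by (simp add: L2_field_def borel_measurable_if)
  have "\<exists>g. g \<in> borel_measurable lborel \<and> (AE z in lborel. u0 z $ i = g z)" for i
  proof -
    have "(\<lambda>z. u0 z $ i) \<in> borel_measurable lebesgue" using u0 by measurable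
    from completion_ex_borel_measurable_real[OF this] show ?thesis by blast
  qed
  then obtain g where g: "\<And>i. g i \<in> borel_measurable lborel" "\<And>i. AE z in lborel. u0 z $ i = g i z"
    by metis
  define w0 :: "real \<times> (real^3) \<Rightarrow> real^3" where "w0 z = (\<chi> i. g i z)" for z
  have w0: "w0 \<in> borel_measurable borel"
    using g(1) by (intro measurable_vec3) (simp add: w0_def)
  have "AE z in lborel. \<forall>i. u0 z $ i = g i z"
    using g(2) by (simp add: AE_all_countable)
  then have ae0: "AE z in lborel. u0 z = w0 z"
    by eventually_elim (simp add: w0_def vec_eq_iff)
  define w where "w z = w0 (fst z, wrap L (snd z))" for z
  have "(\<lambda>z::real \<times> (real^3). (fst z, wrap L (snd z))) \<in> borel_measurable borel"
    by (intro borel_measurable_Pair measurable_compose[OF _ wrap_measurable]) (auto simp: borel_prod[symmetric])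
  from measurable_compose[OF this w0] have wm: "w \<in> borel_measurable borel" by (simp add: w_def[abs_def])
  have wp: "periodic L (\<lambda>x. w (t, x))" for t
    using periodic_comp_wrap[OF L, of "\<lambda>x. w0 (t, x)"] by (simp add: w_def)
  have "AE z in lborel. \<forall>m\<in>period_lattice L. u0 (z + (0, m)) = w0 (z + (0, m))"
    by (subst AE_ball_countable[OF countable_period_lattice]) (intro ballI AE_lborel_translate[OF ae0])
  then have "AE z in lborel. fst z \<in> {0..T} \<longrightarrow> u z = w z"
  proof eventually_elim
    case (elim z)
    show ?case
    proof
      assume t: "fst z \<in> {0..T}"
      have "periodic L (\<lambda>x. u (fst z, x))"
        using u t unfolding L2_field_def space_periodic_def periodic_def by blast
      then have "u z = u (fst z, wrap L (snd z))" using periodic_wrap[of L "\<lambda>x. u (fst z, x)"] by simp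
      also have "\<dots> = u0 (fst z, wrap L (snd z))"
        using t wrap_in_half_open_cell[OF L, of "snd z"] by (auto simp: u0_def Omega_def mem_cell half_open_cell_def less_imp_le)
      also have "(fst z, wrap L (snd z)) = z + (0, - lattice_part L (snd z))"
        by (simp add: prod_eq_iff wrap_def)
      also have "u0 \<dots> = w0 \<dots>" using elim uminus_in_lattice[OF lattice_part_in_lattice] by blast
      also have "\<dots> = w z" by (simp add: w_def prod_eq_iff wrap_def plus_prod_def)
      finally show "u z = w z" .
    qed
  qed
  then show thesis using that wm wp by blast
qed

lemma avg_cong_AE:
  assumes "AE z in lborel. fst z \<in> {0..T} \<longrightarrow> f z = g z"
  shows "avg T L f = avg T L g"
proof -
  have "(\<integral>\<^sup>+z. f z * indicator (Omega T L) z \<partial>lebesgue) = (\<integral>\<^sup>+z. g z * indicator (Omega T L) z \<partial>lebesgue)"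
    unfolding nn_integral_completion
    by (rule nn_integral_cong_AE, use assms in eventually_elim) (auto simp: indicator_def Omega_def)
  then show ?thesis by (simp add: avg_def)
qed

lemma nn_integral_Omega_iterated:
  assumes f: "f \<in> borel_measurable borel"
  shows "(\<integral>\<^sup>+z\<in>Omega T L. f z \<partial>lebesgue) = (\<integral>\<^sup>+t\<in>{0..T}. (\<integral>\<^sup>+x. f (t, x) \<partial>cell_measure L) \<partial>lborel)"
proof -
  have f': "(\<lambda>z. f z * indicator (Omega T L) z) \<in> borel_measurable (lborel \<Otimes>\<^sub>M lborel)"
    using f borel_closed[OF closed_Omega] by (simp add: lborel_prod)
  have "(\<integral>\<^sup>+z\<in>Omega T L. f z \<partial>lebesgue) = (\<integral>\<^sup>+z. f z * indicator (Omega T L) z \<partial>(lborel \<Otimes>\<^sub>M lborel))"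
    by (simp add: nn_integral_completion lborel_prod)
  also have "\<dots> = (\<integral>\<^sup>+t. \<integral>\<^sup>+x. f (t, x) * indicator (Omega T L) (t, x) \<partial>lborel \<partial>lborel)"
    by (rule lborel.nn_integral_fst[OF f', symmetric])
  also have "\<dots> = (\<integral>\<^sup>+t\<in>{0..T}. (\<integral>\<^sup>+x. f (t, x) \<partial>cell_measure L) \<partial>lborel)"
    by (intro nn_integral_cong) (auto simp: Omega_def nn_integral_restrict_space indicator_def)
  finally show ?thesis .
qed

lemma avg_iterated:
  assumes "f \<in> borel_measurable borel"
  shows "avg T L f = (\<integral>\<^sup>+t\<in>{0..T}. (\<integral>\<^sup>+x. f (t, x) \<partial>cell_measure L) \<partial>lborel) / ennreal (T * L ^ 3)"
  unfolding avg_def nn_integral_Omega_iterated[OF assms] ..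

lemma mode_coeff_lborel:
  assumes "f \<in> borel_measurable borel"
  shows "mode_coeff L f k = (LINT x|lborel. indicator (cell L) x *\<^sub>R (of_real (f x) * cnj (fourier_mode k x))) / of_real (L ^ 3)"
  unfolding mode_coeff_def by (subst integral_restrict_space) auto

lemma fourier_coeff_component:
  assumes v: "v \<in> borel_measurable borel"
  shows "fourier_coeff L v k $ i = mode_coeff L (\<lambda>x. v x $ i) k"
proof -
  have m[measurable]: "(\<lambda>x. v x $ i) \<in> borel_measurable borel" using v by measurable
  show ?thesis
    unfolding mode_coeff_lborel[OF m]
    by (simp add: fourier_coeff_def set_lebesgue_integral_def fourier_mode_minus) (subst integral_completion; simp)
qed

lemma fourier_coeff_cong_AE:
  assumes ae: "AE x in lborel. v x = w x" and w[measurable]: "w \<in> borel_measurable borel"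
  shows "fourier_coeff L v k = fourier_coeff L w k"
proof -
  have v: "v \<in> borel_measurable lebesgue" by (rule lebesgue_measurable_AE_cong[OF ae w])
  have "AE x in lebesgue. v x = w x" using ae by (simp add: AE_completion_iff)
  then have "(LINT x:cell L|lebesgue. complex_of_real (v x $ i) * fourier_mode (- k) x)
      = (LINT x:cell L|lebesgue. complex_of_real (w x $ i) * fourier_mode (- k) x)" for i
    unfolding set_lebesgue_integral_def
  proof (intro integral_cong_AE)
    have e: "fourier_mode (- k) \<in> borel_measurable lebesgue"
      by (rule measurable_completion) simp
    have c: "cell L \<in> sets lebesgue" by simp
    have "(\<lambda>x. v x $ i) \<in> borel_measurable lebesgue" "(\<lambda>x. w x $ i) \<in> borel_measurable lebesgue"
      by (intro measurable_vec_component v measurable_completion; simp)+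
    then show "(\<lambda>x. indicator (cell L) x *\<^sub>R (complex_of_real (v x $ i) * fourier_mode (- k) x)) \<in> borel_measurable lebesgue"
       "(\<lambda>x. indicator (cell L) x *\<^sub>R (complex_of_real (w x $ i) * fourier_mode (- k) x)) \<in> borel_measurable lebesgue"
      using e c by measurable
    show "AE x in lebesgue. v x = w x \<Longrightarrow> AE x in lebesgue. indicator (cell L) x *\<^sub>R (complex_of_real (v x $ i) * fourier_mode (- k) x) =
         indicator (cell L) x *\<^sub>R (complex_of_real (w x $ i) * fourier_mode (- k) x)"
      by (erule eventually_mono) simp
  qed
  then show ?thesis by (simp add: fourier_coeff_def)
qed

lemma lp_block_finite_sum:
  assumes chi: "lp_cutoff chi" and L: "L > 0"
  shows "lp_block chi L (int q) u (t, x) =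
    (\<Sum>k\<in>lp_support chi L q. (of_real (lp_symbol chi L (int q) k) * fourier_mode k x) *s fourier_coeff L (\<lambda>y. u (t, y)) k)"
proof -
  have "lp_block chi L (int q) u (t, x) =
    (\<Sum>\<^sub>\<infinity>k\<in>lp_support chi L q. (of_real (lp_symbol chi L (int q) k) * fourier_mode k x) *s fourier_coeff L (\<lambda>y. u (t, y)) k)"
    unfolding lp_block_def prod.case
    by (rule infsum_cong_neutral) (auto simp: lp_support_def)
  then show ?thesis using finite_lp_support[OF chi L] by simp
qed

lemma lp_block_component:
  assumes chi: "lp_cutoff chi" and L: "L > 0" and w: "w \<in> borel_measurable borel"
  shows "lp_block chi L (int q) w (t, x) $ i =
    trig_sum (lp_support chi L q) (\<lambda>k. of_real (lp_symbol chi L (int q) k) * mode_coeff L (\<lambda>x. w (t, x) $ i) k) x"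
proof -
  have "(\<lambda>y. w (t, y)) \<in> borel_measurable borel"
    using measurable_compose[OF _ w, of "\<lambda>y. (t, y)" borel] by (simp add: borel_prod[symmetric])
  then show ?thesis
    by (simp add: lp_block_finite_sum[OF chi L] fourier_coeff_component mult_ac)
qed

lemma norm_vec_squared: "(norm (v :: 'a::real_normed_vector ^ 'n))\<^sup>2 = (\<Sum>i\<in>UNIV. (norm (v $ i))\<^sup>2)"
  by (simp add: norm_vec_def L2_set_def sum_nonneg)

lemma lp_block_norm_measurable:
  assumes chi: "lp_cutoff chi" and L: "L > 0" and w: "w \<in> borel_measurable borel"
  shows "(\<lambda>z. norm (lp_block chi L (int q) w z)) \<in> borel_measurable borel"
proof -
  have wm: "(\<lambda>y. w (t, y)) \<in> borel_measurable borel" for t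
    using measurable_compose[OF _ w, of "\<lambda>y. (t, y)" borel] by (simp add: borel_prod[symmetric])
  have c: "(\<lambda>t. mode_coeff L (\<lambda>x. w (t, x) $ i) k) \<in> borel_measurable borel" for i k
  proof -
    have [measurable]: "w \<in> borel_measurable (lborel \<Otimes>\<^sub>M lborel)" using w by (simp add: lborel_prod)
    have "(\<lambda>t. LINT x|lborel. indicator (cell L) x *\<^sub>R (of_real (w (t, x) $ i) * cnj (fourier_mode k x))) \<in> borel_measurable lborel"
      by (rule lborel.borel_measurable_lebesgue_integral) measurable
    then show ?thesis using wm by (subst mode_coeff_lborel) auto
  qed
  have comp: "(\<lambda>z. lp_block chi L (int q) w z $ i) \<in> borel_measurable borel" for i
  proof -
    have [measurable]: "(\<lambda>z::real \<times> (real^3). mode_coeff L (\<lambda>x. w (fst z, x) $ i) k) \<in> borel_measurable (borel \<Otimes>\<^sub>M borel)" for k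
      using measurable_compose[OF measurable_fst c] .
    have "(\<lambda>z. trig_sum (lp_support chi L q) (\<lambda>k. of_real (lp_symbol chi L (int q) k) * mode_coeff L (\<lambda>x. w (fst z, x) $ i) k) (snd z))
       \<in> borel_measurable (borel \<Otimes>\<^sub>M borel)" by measurable
    moreover have "lp_block chi L (int q) w z $ i = trig_sum (lp_support chi L q) (\<lambda>k. of_real (lp_symbol chi L (int q) k) * mode_coeff L (\<lambda>x. w (fst z, x) $ i) k) (snd z)" for z
      using lp_block_component[OF chi L w, of q "fst z" "snd z"] by simp
    ultimately show ?thesis by (simp add: borel_prod)
  qed
  have "norm (lp_block chi L (int q) w z) = sqrt (\<Sum>i\<in>UNIV. (norm (lp_block chi L (int q) w z $ i))\<^sup>2)" for z
    by (simp add: norm_vec_def L2_set_def)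
  then show ?thesis using comp by simp
qed

lemma increment_le_blocks_slice:
  assumes chi: "lp_cutoff chi" and L: "L > 0" and w: "w \<in> borel_measurable borel"
    and per: "\<And>t. periodic L (\<lambda>x. w (t, x))"
    and fin: "(\<integral>\<^sup>+x. ennreal ((norm (w (t, x)))\<^sup>2) \<partial>cell_measure L) < \<infinity>"
  shows "(\<integral>\<^sup>+x. ennreal ((norm (increment y w (t, x)))\<^sup>2) \<partial>cell_measure L)
    \<le> (\<Sum>q. ennreal (increment_weight (norm y / L) q) *
         (\<integral>\<^sup>+x. ennreal ((norm (lp_block chi L (int q) w (t, x)))\<^sup>2) \<partial>cell_measure L))"
proof -
  let ?M = "cell_measure L"
  have wm[measurable]: "(\<lambda>y. w (t, y)) \<in> borel_measurable borel"
    using measurable_compose[OF _ w, of "\<lambda>y. (t, y)" borel] by (simp add: borel_prod[symmetric])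
  have fm[measurable]: "(\<lambda>x. w (t, x) $ i) \<in> borel_measurable borel" for i by measurable
  let ?B = "\<lambda>q i x. trig_sum (lp_support chi L q) (\<lambda>k. of_real (lp_symbol chi L (int q) k) * mode_coeff L (\<lambda>x. w (t, x) $ i) k) x"
  have comp: "(\<integral>\<^sup>+x. ennreal ((w (t, x + y) $ i - w (t, x) $ i)\<^sup>2) \<partial>?M)
     \<le> (\<Sum>q. ennreal (increment_weight (norm y / L) q) * (\<integral>\<^sup>+x. ennreal ((norm (?B q i x))\<^sup>2) \<partial>?M))" for i
  proof (rule increment_le_blocks_scalar[OF chi L fm])
    show "periodic L (\<lambda>x. w (t, x) $ i)" using per[of t] by (simp add: periodic_def)
    show "integrable ?M (\<lambda>x. (w (t, x) $ i)\<^sup>2)"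
    proof (rule integrableI_bounded)
      show "(\<lambda>x. (w (t, x) $ i)\<^sup>2) \<in> borel_measurable ?M" by (rule cell_measure_borel) measurable
      have "(\<integral>\<^sup>+x. ennreal (norm ((w (t, x) $ i)\<^sup>2)) \<partial>?M) \<le> (\<integral>\<^sup>+x. ennreal ((norm (w (t, x)))\<^sup>2) \<partial>?M)"
        using component_le_norm_cart by (intro nn_integral_mono ennreal_leI) (simp add: abs_le_square_iff[symmetric])
      then show "(\<integral>\<^sup>+x. ennreal (norm ((w (t, x) $ i)\<^sup>2)) \<partial>?M) < \<infinity>" using fin by (rule le_less_trans)
    qed
  qed
  have [measurable]: "(\<lambda>x. ennreal ((w (t, x + y) $ i - w (t, x) $ i)\<^sup>2)) \<in> borel_measurable ?M" for i
    by (rule cell_measure_borel) (use measurable_compose[OF _ fm, of "\<lambda>x. x + y" borel i] in measurable)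
  have [measurable]: "(\<lambda>x. ennreal ((norm (?B q i x))\<^sup>2)) \<in> borel_measurable ?M" for q i
    by (rule cell_measure_borel) measurable
  have "(\<integral>\<^sup>+x. ennreal ((norm (increment y w (t, x)))\<^sup>2) \<partial>?M)
      = (\<integral>\<^sup>+x. (\<Sum>i\<in>UNIV. ennreal ((w (t, x + y) $ i - w (t, x) $ i)\<^sup>2)) \<partial>?M)"
    by (simp add: increment_def norm_vec_squared)
  also have "\<dots> = (\<Sum>i\<in>UNIV. (\<integral>\<^sup>+x. ennreal ((w (t, x + y) $ i - w (t, x) $ i)\<^sup>2) \<partial>?M))"
    by (rule nn_integral_sum) measurable
  also have "\<dots> \<le> (\<Sum>i\<in>UNIV. \<Sum>q. ennreal (increment_weight (norm y / L) q) * (\<integral>\<^sup>+x. ennreal ((norm (?B q i x))\<^sup>2) \<partial>?M))"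
    by (intro sum_mono comp)
  also have "\<dots> = (\<Sum>q. \<Sum>i\<in>UNIV. ennreal (increment_weight (norm y / L) q) * (\<integral>\<^sup>+x. ennreal ((norm (?B q i x))\<^sup>2) \<partial>?M))"
    by (rule suminf_sum[symmetric]) simp
  also have "\<dots> = (\<Sum>q. ennreal (increment_weight (norm y / L) q) *
         (\<integral>\<^sup>+x. ennreal ((norm (lp_block chi L (int q) w (t, x)))\<^sup>2) \<partial>?M))"
  proof (rule suminf_cong)
    fix q
    have "(\<integral>\<^sup>+x. ennreal ((norm (lp_block chi L (int q) w (t, x)))\<^sup>2) \<partial>?M)
        = (\<integral>\<^sup>+x. (\<Sum>i\<in>UNIV. ennreal ((norm (?B q i x))\<^sup>2)) \<partial>?M)"
      unfolding norm_vec_squared lp_block_component[OF chi L w] by (subst sum_ennreal) auto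
    also have "\<dots> = (\<Sum>i\<in>UNIV. \<integral>\<^sup>+x. ennreal ((norm (?B q i x))\<^sup>2) \<partial>?M)"
      by (rule nn_integral_sum) measurable
    finally show "(\<Sum>i\<in>UNIV. ennreal (increment_weight (norm y / L) q) * (\<integral>\<^sup>+x. ennreal ((norm (?B q i x))\<^sup>2) \<partial>?M))
       = ennreal (increment_weight (norm y / L) q) * (\<integral>\<^sup>+x. ennreal ((norm (lp_block chi L (int q) w (t, x)))\<^sup>2) \<partial>?M)"
      by (simp add: sum_distrib_left)
  qed
  finally show ?thesis .
qed

lemma nn_integral_slice_measurable:
  assumes "(f :: real \<times> (real^3) \<Rightarrow> ennreal) \<in> borel_measurable borel"
  shows "(\<lambda>t. \<integral>\<^sup>+x. f (t, x) \<partial>cell_measure L) \<in> borel_measurable borel"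
proof -
  have [measurable]: "f \<in> borel_measurable (lborel \<Otimes>\<^sub>M lborel)" using assms by (simp add: lborel_prod)
  have "(\<lambda>t. \<integral>\<^sup>+x. f (t, x) * indicator (cell L) x \<partial>lborel) \<in> borel_measurable lborel" by measurable
  then show ?thesis by (simp add: nn_integral_restrict_space)
qed

lemma increment_le_blocks_borel:
  assumes chi: "lp_cutoff chi" and L: "L > 0" and w: "w \<in> borel_measurable borel"
    and per: "\<And>t. periodic L (\<lambda>x. w (t, x))"
    and fin: "(\<integral>\<^sup>+t\<in>{0..T}. (\<integral>\<^sup>+x. ennreal ((norm (w (t, x)))\<^sup>2) \<partial>cell_measure L) \<partial>lborel) < \<infinity>"
  shows "avg T L (\<lambda>z. ennreal ((norm (increment y w z))\<^sup>2))
    \<le> (\<Sum>q. ennreal (increment_weight (norm y / L) q) * block_moment chi T L w 2 q)"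
proof -
  let ?W = "\<lambda>q. ennreal (increment_weight (norm y / L) q)"
  let ?I = "\<lambda>q t. \<integral>\<^sup>+x. ennreal ((norm (lp_block chi L (int q) w (t, x)))\<^sup>2) \<partial>cell_measure L"
  note [measurable] = w
  have bm: "(\<lambda>z. ennreal ((norm (lp_block chi L (int q) w z))\<^sup>2)) \<in> borel_measurable borel" for q
    using lp_block_norm_measurable[OF chi L w, of q] by measurable
  have Im[measurable]: "?I q \<in> borel_measurable borel" for q
    by (rule nn_integral_slice_measurable[OF bm])
  have m: "(\<lambda>z. ennreal ((norm (increment y w z))\<^sup>2)) \<in> borel_measurable borel"
  proof -
    have "(\<lambda>z::real \<times> (real^3). (fst z, snd z + y)) \<in> borel_measurable borel"
      by (intro borel_measurable_Pair) (auto simp: borel_prod[symmetric])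
    from measurable_compose[OF this w] have "(\<lambda>z. w (fst z, snd z + y)) \<in> borel_measurable borel" .
    then have "(\<lambda>z. ennreal ((norm (w (fst z, snd z + y) - w z))\<^sup>2)) \<in> borel_measurable borel" by measurable
    then show ?thesis by (simp add: increment_def case_prod_beta')
  qed
  have w2: "(\<lambda>t. (\<integral>\<^sup>+x. ennreal ((norm (w (t, x)))\<^sup>2) \<partial>cell_measure L)) \<in> borel_measurable borel"
    by (rule nn_integral_slice_measurable) measurable
  have ae: "AE t in lborel. (\<integral>\<^sup>+x. ennreal ((norm (w (t, x)))\<^sup>2) \<partial>cell_measure L) * indicator {0..T} t \<noteq> \<infinity>"
    using w2 fin by (intro nn_integral_PInf_AE) auto
  have "(\<integral>\<^sup>+t\<in>{0..T}. (\<integral>\<^sup>+x. ennreal ((norm (increment y w (t, x)))\<^sup>2) \<partial>cell_measure L) \<partial>lborel)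
     \<le> (\<integral>\<^sup>+t. (\<Sum>q. ?W q * (?I q t * indicator {0..T} t)) \<partial>lborel)"
  proof (rule nn_integral_mono_AE, use ae in eventually_elim)
    case (elim t)
    show ?case
    proof (cases "t \<in> {0..T}")
      case True
      then have "(\<integral>\<^sup>+x. ennreal ((norm (w (t, x)))\<^sup>2) \<partial>cell_measure L) < \<infinity>"
        using elim by (simp add: less_top)
      from increment_le_blocks_slice[OF chi L w per this, of y] show ?thesis using True by simp
    qed simp
  qed
  also have "\<dots> = (\<Sum>q. ?W q * (\<integral>\<^sup>+t\<in>{0..T}. ?I q t \<partial>lborel))"
    by (subst nn_integral_suminf) (auto simp: nn_integral_cmult)
  finally have "(\<integral>\<^sup>+t\<in>{0..T}. (\<integral>\<^sup>+x. ennreal ((norm (increment y w (t, x)))\<^sup>2) \<partial>cell_measure L) \<partial>lborel) / ennreal (T * L ^ 3)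
     \<le> (\<Sum>q. ?W q * (\<integral>\<^sup>+t\<in>{0..T}. ?I q t \<partial>lborel)) / ennreal (T * L ^ 3)"
    by (rule divide_right_mono_ennreal)
  then show ?thesis
    unfolding avg_iterated[OF m] block_moment_def avg_iterated[OF bm] ennreal_suminf_divide[symmetric] ennreal_times_divide .
qed

text \<open>The Fourier coefficients of a slice depend only on its class up to null sets, and by Fubini
  almost every slice of \<open>u\<close> is in the class of the slice of \<open>w\<close>.\<close>

lemma block_moment_cong_AE:
  assumes chi: "lp_cutoff chi" and L: "L > 0" and w: "w \<in> borel_measurable borel"
    and ae: "AE z in lborel. fst z \<in> {0..T} \<longrightarrow> u z = w z"
  shows "block_moment chi T L u p q = block_moment chi T L w p q"
proof -
  have wm: "(\<lambda>y. w (t, y)) \<in> borel_measurable borel" for t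
    using measurable_compose[OF _ w, of "\<lambda>y. (t, y)" borel] by (simp add: borel_prod[symmetric])
  have "AE t in lborel. AE x in lborel. t \<in> {0..T} \<longrightarrow> u (t, x) = w (t, x)"
    using AE_lborel_sections[OF ae] by simp
  then have "AE t in lborel. t \<in> {0..T} \<longrightarrow> (\<forall>x. lp_block chi L (int q) u (t, x) = lp_block chi L (int q) w (t, x))"
  proof eventually_elim
    case (elim t)
    show ?case
    proof (intro impI allI)
      fix x assume "t \<in> {0..T}"
      with elim have "AE x in lborel. u (t, x) = w (t, x)" by simp
      then have "fourier_coeff L (\<lambda>y. u (t, y)) k = fourier_coeff L (\<lambda>y. w (t, y)) k" for k
        by (rule fourier_coeff_cong_AE) (rule wm)
      then show "lp_block chi L (int q) u (t, x) = lp_block chi L (int q) w (t, x)"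
        by (simp add: lp_block_def)
    qed
  qed
  from AE_lborel_fst[OF this]
  have "AE z in (lborel :: (real \<times> (real^3)) measure). fst z \<in> {0..T} \<longrightarrow>
      ennreal (norm (lp_block chi L (int q) u z) ^ p) = ennreal (norm (lp_block chi L (int q) w z) ^ p)"
    by eventually_elim (metis prod.collapse)
  then show ?thesis unfolding block_moment_def by (rule avg_cong_AE)
qed

lemma avg_increment_cong_AE:
  assumes ae: "AE z in lborel. fst z \<in> {0..T} \<longrightarrow> u z = w z"
  shows "avg T L (\<lambda>z. ennreal ((norm (increment y u z))\<^sup>2)) = avg T L (\<lambda>z. ennreal ((norm (increment y w z))\<^sup>2))"
proof (rule avg_cong_AE)
  show "AE z in lborel. fst z \<in> {0..T} \<longrightarrow>
      ennreal ((norm (increment y u z))\<^sup>2) = ennreal ((norm (increment y w z))\<^sup>2)"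
    using ae AE_lborel_translate[OF ae, of "(0, y)"]
    by eventually_elim (simp add: increment_def case_prod_beta' plus_prod_def)
qed

text \<open>The estimate in which all the Fourier analysis is condensed. It depends on \<open>y\<close> only through
  its length, which makes the average over directions harmless.\<close>

proposition increment_le_blocks:
  assumes chi: "lp_cutoff chi" and L: "L > 0" and u: "L2_field T L u"
  shows "avg T L (\<lambda>z. ennreal ((norm (increment y u z))\<^sup>2))
    \<le> (\<Sum>q. ennreal (increment_weight (norm y / L) q) * block_moment chi T L u 2 q)"
proof -
  obtain w where w: "w \<in> borel_measurable borel" and per: "\<And>t. periodic L (\<lambda>x. w (t, x))"
    and ae: "AE z in lborel. fst z \<in> {0..T} \<longrightarrow> u z = w z"
    using borel_periodic_representative[OF L u] by blast
  have "(\<integral>\<^sup>+z. ennreal ((norm (w z))\<^sup>2) * indicator (Omega T L) z \<partial>lebesgue)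
      = (\<integral>\<^sup>+z. ennreal ((norm (u z))\<^sup>2) * indicator (Omega T L) z \<partial>lebesgue)"
    unfolding nn_integral_completion
    by (rule nn_integral_cong_AE, use ae in eventually_elim) (auto simp: indicator_def Omega_def)
  also have "\<dots> < \<infinity>"
    using u Omega_lebesgue by (auto simp: L2_field_def integrable_iff_bounded nn_integral_restrict_space)
  finally have "(\<integral>\<^sup>+t\<in>{0..T}. (\<integral>\<^sup>+x. ennreal ((norm (w (t, x)))\<^sup>2) \<partial>cell_measure L) \<partial>lborel) < \<infinity>"
    using w by (subst (asm) nn_integral_Omega_iterated) auto
  from increment_le_blocks_borel[OF chi L w per this, of y] show ?thesis
    unfolding avg_increment_cong_AE[OF ae] block_moment_cong_AE[OF chi L w ae] .
qed

section \<open>Moments of the blocks and the intermittency dimension\<close>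

lemma avg_one:
  assumes "L > 0" "T > 0"
  shows "avg T L (\<lambda>_. 1) = 1"
proof -
  have "(\<integral>\<^sup>+z\<in>Omega T L. 1 \<partial>lebesgue) = (\<integral>\<^sup>+t\<in>{0..T}. ennreal (L ^ 3) \<partial>lborel)"
    using assms by (subst nn_integral_Omega_iterated)
      (auto simp: emeasure_restrict_space space_restrict_space emeasure_cell)
  also have "\<dots> = ennreal (T * L ^ 3)"
    using assms by (subst nn_integral_cmult_indicator) (auto simp: ennreal_mult mult.commute)
  finally show ?thesis using assms by (simp add: avg_def ennreal_divide_self)
qed

lemma avg_linear:
  assumes f: "f \<in> borel_measurable borel" and g: "g \<in> borel_measurable borel"
  shows "avg T L (\<lambda>z. c * f z + g z) = c * avg T L f + avg T L g"
proof -
  have [measurable]: "Omega T L \<in> sets borel" by (rule borel_closed[OF closed_Omega])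
  note [measurable] = f g
  have "(\<integral>\<^sup>+z. (c * f z + g z) * indicator (Omega T L) z \<partial>lborel)
     = (\<integral>\<^sup>+z. c * (f z * indicator (Omega T L) z) + g z * indicator (Omega T L) z \<partial>lborel)"
    by (simp add: distrib_right mult.assoc)
  also have "\<dots> = c * (\<integral>\<^sup>+z. f z * indicator (Omega T L) z \<partial>lborel) + (\<integral>\<^sup>+z. g z * indicator (Omega T L) z \<partial>lborel)"
    by (subst nn_integral_add) (auto simp: nn_integral_cmult)
  finally show ?thesis
    by (simp add: avg_def nn_integral_completion add_divide_distrib_ennreal ennreal_times_divide)
qed

lemma avg_mono: "(\<And>z. f z \<le> g z) \<Longrightarrow> avg T L f \<le> avg T L g"
  unfolding avg_def by (intro divide_right_mono_ennreal nn_integral_mono mult_right_mono) auto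

text \<open>The factorisation \<open>2f\<^sup>3 - 3\<tau>f\<^sup>2 + \<tau>\<^sup>3 = (f - \<tau>)\<^sup>2 (2f + \<tau>)\<close> is Young's inequality for
  these exponents; the optimal \<open>\<tau>\<close> is the cube root of the third moment.\<close>

lemma avg_square_le_avg_cube:
  assumes L: "L > 0" and T: "T > 0" and f[measurable]: "f \<in> borel_measurable borel" and f0: "\<And>z. 0 \<le> f z"
    and b: "0 \<le> b" "avg T L (\<lambda>z. ennreal (f z ^ 3)) \<le> ennreal b"
  shows "avg T L (\<lambda>z. ennreal (f z ^ 2)) \<le> ennreal (b powr (2 / 3))"
proof -
  have young: "avg T L (\<lambda>z. ennreal (f z ^ 2)) \<le> ennreal (2 / (3 * \<tau>) * b + \<tau>\<^sup>2 / 3)" if \<tau>: "\<tau> > 0" for \<tau> :: real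
  proof -
    have pw: "ennreal (f z ^ 2) \<le> ennreal (2 / (3 * \<tau>)) * ennreal (f z ^ 3) + ennreal (\<tau>\<^sup>2 / 3)" for z
    proof -
      have "0 \<le> (f z - \<tau>)\<^sup>2 * (2 * f z + \<tau>)" using f0[of z] \<tau> by simp
      also have "\<dots> = 2 * f z ^ 3 - 3 * \<tau> * f z ^ 2 + \<tau> ^ 3"
        by (simp add: power2_eq_square power3_eq_cube algebra_simps)
      finally have "f z ^ 2 \<le> 2 / (3 * \<tau>) * f z ^ 3 + \<tau>\<^sup>2 / 3"
        using \<tau> by (simp add: field_simps power2_eq_square power3_eq_cube)
      then have "ennreal (f z ^ 2) \<le> ennreal (2 / (3 * \<tau>) * f z ^ 3 + \<tau>\<^sup>2 / 3)" by (rule ennreal_leI)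
      also have "\<dots> = ennreal (2 / (3 * \<tau>)) * ennreal (f z ^ 3) + ennreal (\<tau>\<^sup>2 / 3)"
        using \<tau> f0[of z] by (subst ennreal_plus) (auto simp: ennreal_mult[symmetric])
      finally show ?thesis .
    qed
    have "avg T L (\<lambda>z. ennreal (f z ^ 2))
        \<le> avg T L (\<lambda>z. ennreal (2 / (3 * \<tau>)) * ennreal (f z ^ 3) + ennreal (\<tau>\<^sup>2 / 3) * 1)"
      using pw by (intro avg_mono) simp
    also have "\<dots> = ennreal (2 / (3 * \<tau>)) * avg T L (\<lambda>z. ennreal (f z ^ 3)) + avg T L (\<lambda>z. ennreal (\<tau>\<^sup>2 / 3) * 1 + 0)"
      by (subst avg_linear) auto
    also have "avg T L (\<lambda>z. ennreal (\<tau>\<^sup>2 / 3) * 1 + 0) = ennreal (\<tau>\<^sup>2 / 3)"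
      by (subst avg_linear) (auto simp: avg_one[OF L T], simp add: avg_def)
    also have "ennreal (2 / (3 * \<tau>)) * avg T L (\<lambda>z. ennreal (f z ^ 3)) + ennreal (\<tau>\<^sup>2 / 3)
        \<le> ennreal (2 / (3 * \<tau>)) * ennreal b + ennreal (\<tau>\<^sup>2 / 3)"
      by (intro add_right_mono mult_left_mono b) auto
    also have "\<dots> = ennreal (2 / (3 * \<tau>) * b + \<tau>\<^sup>2 / 3)"
      using \<tau> b(1) by (subst ennreal_plus) (auto simp: ennreal_mult[symmetric])
    finally show ?thesis .
  qed
  show ?thesis
  proof (cases "b = 0")
    case True
    show ?thesis
    proof (rule ennreal_le_epsilon)
      fix e :: real assume "0 < e"
      then show "avg T L (\<lambda>z. ennreal (f z ^ 2)) \<le> ennreal (b powr (2 / 3)) + ennreal e"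
        using young[of "sqrt (3 * e)"] True by simp
    qed
  next
    case False
    then have "b > 0" using b by simp
    define \<tau> where "\<tau> = b powr (1 / 3)"
    have \<tau>: "\<tau> > 0" "\<tau> ^ 3 = b" "\<tau>\<^sup>2 = b powr (2 / 3)"
      using \<open>b > 0\<close> by (simp_all add: \<tau>_def powr_power)
    have "2 / (3 * \<tau>) * b + \<tau>\<^sup>2 / 3 = \<tau>\<^sup>2"
      unfolding \<tau>(2)[symmetric] using \<tau>(1) by (simp add: field_simps power2_eq_square power3_eq_cube)
    then show ?thesis using young[OF \<tau>(1)] by (simp only: \<tau>(3))
  qed
qed

lemma block_moment_le:
  assumes chi: "lp_cutoff chi" and L: "L > 0" and T: "T > 0" and u: "L2_field T L u"
    and b: "0 \<le> b" "block_moment chi T L u 3 q \<le> ennreal b"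
  shows "block_moment chi T L u 2 q \<le> ennreal (b powr (2 / 3))"
proof -
  obtain w where w: "w \<in> borel_measurable borel" and ae: "AE z in lborel. fst z \<in> {0..T} \<longrightarrow> u z = w z"
    using borel_periodic_representative[OF L u] by blast
  show ?thesis
    using avg_square_le_avg_cube[OF L T lp_block_norm_measurable[OF chi L w] norm_ge_zero b(1), of q] b(2)
    unfolding block_moment_cong_AE[OF chi L w ae] by (simp add: block_moment_def)
qed

lemma third_moment_le:
  assumes L: "L > 0" and E: "eps_bar chi T L u < \<infinity>"
  shows "block_moment chi T L u 3 q \<le> ennreal (enn2real (eps_bar chi T L u) / lambda L q)"
proof -
  have l: "lambda L q > 0" by (rule lambda_pos[OF L])
  have "ennreal (lambda L q) * block_moment chi T L u 3 q \<le> eps_bar chi T L u"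
    unfolding eps_bar_def by (rule SUP_upper) simp
  also have "\<dots> = ennreal (enn2real (eps_bar chi T L u))" using E by simp
  finally have "block_moment chi T L u 3 q * ennreal (lambda L q) \<le> ennreal (enn2real (eps_bar chi T L u))"
    by (simp add: mult.commute)
  from divide_right_mono_ennreal[OF this, of "ennreal (lambda L q)"] show ?thesis
    using l by (simp add: ennreal_mult_divide_eq divide_ennreal)
qed

text \<open>Finiteness of \<^const>\<open>eps_bar\<close> makes both moments finite, which lets the dimension of a block
  be computed with real numbers.\<close>

lemma block_moments_real:
  assumes chi: "lp_cutoff chi" and L: "L > 0" and T: "T > 0" and u: "L2_field T L u"
    and E: "eps_bar chi T L u < \<infinity>"
  obtains a b where "0 \<le> a" "0 \<le> b" "block_moment chi T L u 2 q = ennreal a" "block_moment chi T L u 3 q = ennreal b"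
    "a \<le> b powr (2 / 3)" "b \<le> enn2real (eps_bar chi T L u) / lambda L q"
proof -
  let ?b = "enn2real (block_moment chi T L u 3 q)" and ?a = "enn2real (block_moment chi T L u 2 q)"
  have 3: "block_moment chi T L u 3 q = ennreal ?b"
    using le_less_trans[OF third_moment_le[OF L E, of q] ennreal_less_top] by simp
  have 2: "block_moment chi T L u 2 q \<le> ennreal (?b powr (2 / 3))"
    by (rule block_moment_le[OF chi L T u]) (simp_all add: 3[symmetric])
  have m2: "block_moment chi T L u 2 q = ennreal ?a"
    using le_less_trans[OF 2 ennreal_less_top] by simp
  show thesis
  proof (rule that[OF _ _ m2 3])
    show "?a \<le> ?b powr (2 / 3)" using enn2real_mono[OF 2] by simp
    show "?b \<le> enn2real (eps_bar chi T L u) / lambda L q"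
      using enn2real_mono[OF third_moment_le[OF L E, of q]] lambda_pos[OF L, of q] by simp
  qed auto
qed

lemma powr_two_thirds_cube:
  assumes "(b::real) \<ge> 0"
  shows "(b powr (2 / 3)) ^ 3 = b\<^sup>2"
  using assms by (cases "b = 0") (simp_all add: powr_power)

lemma active_volume_real:
  assumes L: "L > 0" and "0 \<le> a" "0 < b" "block_moment chi T L u 2 q = ennreal a" "block_moment chi T L u 3 q = ennreal b"
  shows "active_volume chi T L u q = ennreal (L ^ 3 * a ^ 3 / b ^ 2)"
  using assms by (simp add: active_volume_def ennreal_power ennreal_mult[symmetric] divide_ennreal)

text \<open>The inequality between the second and the third moment says that the active volume is at
  most \<open>L\<^sup>3\<close>.\<close>

lemma dim_at_le_3:
  assumes chi: "lp_cutoff chi" and L: "L > 0" and T: "T > 0" and u: "L2_field T L u"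
    and E: "eps_bar chi T L u < \<infinity>"
  shows "dim_at chi T L u q \<le> 3"
proof (cases "active_volume chi T L u q = 0")
  case True
  then show ?thesis by (simp add: dim_at_def)
next
  case False
  obtain a b where ab: "0 \<le> a" "0 \<le> b" "block_moment chi T L u 2 q = ennreal a" "block_moment chi T L u 3 q = ennreal b"
    "a \<le> b powr (2 / 3)" by (rule block_moments_real[OF chi L T u E])
  have "b \<noteq> 0" using False ab by (auto simp: active_volume_def)
  then have b: "b > 0" using ab by simp
  have V: "active_volume chi T L u q = ennreal (L ^ 3 * a ^ 3 / b ^ 2)"
    by (rule active_volume_real[OF L ab(1) b ab(3,4)])
  have a: "a > 0" using False ab(1) by (cases "a = 0") (auto simp: V)
  have "a ^ 3 \<le> b\<^sup>2"
    using power_mono[OF ab(5,1), of 3] powr_two_thirds_cube[OF ab(2)] by simp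
  then have "1 \<le> b\<^sup>2 / a ^ 3" using a by simp
  also have "\<dots> = L ^ 3 / enn2real (active_volume chi T L u q)"
    using L a b by (simp add: V)
  finally have "0 \<le> log 2 (L ^ 3 / enn2real (active_volume chi T L u q)) / real q"
    by simp
  then show ?thesis using False by (simp add: dim_at_def)
qed

lemma intermittency_dim_le_3:
  assumes "lp_cutoff chi" "L > 0" "T > 0" "L2_field T L u" "eps_bar chi T L u < \<infinity>"
  shows "intermittency_dim chi T L u \<le> 3"
  unfolding intermittency_dim_def by (intro Limsup_bounded always_eventually allI dim_at_le_3[OF assms])

text \<open>Let \<open>a > 0\<close> and \<open>b\<close> be the second and the third moment of a block. Then \<open>D\<^sub>q < d\<close> means
  \<open>a\<^sup>3 < b\<^sup>2 2\<^bsup>-q(3-d)\<^esup>\<close>, and since \<open>b\<close> is at most the supremum divided by \<open>\<lambda>\<^sub>q\<close>, this gives the bound with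
  \<open>A = 1\<close>. It is available for all but finitely many \<open>q\<close>; for the others \<open>a \<le> b\<^bsup>2/3\<^esup>\<close> suffices once
  \<open>A\<close> is large. Thus \<open>A\<close> depends on \<open>u\<close> and \<open>d\<close>.\<close>

lemma second_moment_decay:
  assumes chi: "lp_cutoff chi" and L: "L > 0" and T: "T > 0" and u: "L2_field T L u"
    and E: "eps_bar chi T L u < \<infinity>" and d: "intermittency_dim chi T L u < ereal d"
  shows "\<exists>A\<ge>0. \<forall>q. block_moment chi T L u 2 q
    \<le> ennreal (A * (enn2real (eps_bar chi T L u) / lambda L q) powr (2 / 3) * 2 powr (- (real q * (1 - d / 3))))"
proof -
  let ?E = "enn2real (eps_bar chi T L u)" and ?s = "1 - d / 3"
  have "eventually (\<lambda>q. dim_at chi T L u q < ereal d) sequentially"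
    using d unfolding intermittency_dim_def by (rule Limsup_lessD)
  then obtain Q0 where Q0: "\<And>q. q \<ge> Q0 \<Longrightarrow> dim_at chi T L u q < ereal d"
    by (auto simp: eventually_sequentially)
  \<comment> \<open>the successor excludes \<open>q = 0\<close>, where \<open>dim_at\<close> divides by zero\<close>
  define Q where "Q = Suc Q0"
  define A where "A = 2 powr (real Q * \<bar>?s\<bar>)"
  have A1: "1 \<le> A" by (simp add: A_def ge_one_powr_ge_zero)
  have "block_moment chi T L u 2 q \<le> ennreal (A * (?E / lambda L q) powr (2 / 3) * 2 powr (- (real q * ?s)))" for q
  proof -
    obtain a b where ab: "0 \<le> a" "0 \<le> b" "block_moment chi T L u 2 q = ennreal a" "block_moment chi T L u 3 q = ennreal b"
      "a \<le> b powr (2 / 3)" "b \<le> ?E / lambda L q" by (rule block_moments_real[OF chi L T u E])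
    have bE: "b powr (2 / 3) \<le> (?E / lambda L q) powr (2 / 3)" using ab by (intro powr_mono2) auto
    have "a \<le> A * (?E / lambda L q) powr (2 / 3) * 2 powr (- (real q * ?s))"
    proof (cases "q < Q")
      case True
      have "- (real Q * \<bar>?s\<bar>) \<le> - (real q * ?s)"
      proof -
        have "real q * ?s \<le> real q * \<bar>?s\<bar>" by (intro mult_left_mono) auto
        also have "\<dots> \<le> real Q * \<bar>?s\<bar>" using True by (intro mult_right_mono) auto
        finally show ?thesis by simp
      qed
      then have "2 powr (- (real Q * \<bar>?s\<bar>)) \<le> (2::real) powr (- (real q * ?s))" by simp
      then have "A * 2 powr (- (real Q * \<bar>?s\<bar>)) \<le> A * 2 powr (- (real q * ?s))" using A1 by (intro mult_left_mono) auto
      then have "1 \<le> A * 2 powr (- (real q * ?s))" by (simp add: A_def powr_add[symmetric])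
      then have "(?E / lambda L q) powr (2 / 3) * 1 \<le> (?E / lambda L q) powr (2 / 3) * (A * 2 powr (- (real q * ?s)))"
        by (intro mult_left_mono) auto
      then show ?thesis using ab(5) bE by (simp add: mult_ac)
    next
      case False
      then have q: "q \<ge> Q0" "q > 0" by (auto simp: Q_def)
      show ?thesis
      proof (cases "a = 0")
        case True
        then show ?thesis using A1 by simp
      next
        case a0: False
        then have a: "a > 0" using ab by simp
        have "b \<noteq> 0" using ab(5) a by auto
        then have b: "b > 0" using ab by simp
        have V: "active_volume chi T L u q = ennreal (L ^ 3 * a ^ 3 / b ^ 2)"
          by (rule active_volume_real[OF L ab(1) b ab(3,4)])
        have "L ^ 3 * a ^ 3 / b ^ 2 > 0" using L a b by simp
        then have "dim_at chi T L u q = ereal (3 - log 2 (b\<^sup>2 / a ^ 3) / real q)"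
          using L a b by (simp add: dim_at_def V)
        then have "3 - log 2 (b\<^sup>2 / a ^ 3) / real q < d" using Q0[OF q(1)] by simp
        then have "real q * (3 - d) < log 2 (b\<^sup>2 / a ^ 3)" using q by (simp add: field_simps)
        then have "2 powr (real q * (3 - d)) < b\<^sup>2 / a ^ 3" using a b by (simp add: powr_less_iff)
        then have "a ^ 3 * 2 powr (real q * (3 - d)) < b\<^sup>2"
          using a by (simp add: pos_less_divide_eq mult.commute)
        then have "a ^ 3 < b\<^sup>2 / 2 powr (real q * (3 - d))"
          by (subst pos_less_divide_eq) simp_all
        also have "\<dots> = b\<^sup>2 * 2 powr (- (real q * (3 - d)))"
          by (simp only: powr_minus divide_inverse)
        also have "\<dots> = (b powr (2 / 3) * 2 powr (- (real q * ?s))) ^ 3"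
          using powr_two_thirds_cube[OF ab(2)] by (simp add: power_mult_distrib powr_power algebra_simps)
        finally have "a \<le> b powr (2 / 3) * 2 powr (- (real q * ?s))"
          by (intro power_le_imp_le_base[where n=2 and a=a, simplified numeral_3_eq_3[symmetric]]) auto
        also have "\<dots> \<le> (?E / lambda L q) powr (2 / 3) * 2 powr (- (real q * ?s))"
          using bE by (intro mult_right_mono) auto
        also have "\<dots> = 1 * ((?E / lambda L q) powr (2 / 3) * 2 powr (- (real q * ?s)))" by simp
        also have "\<dots> \<le> A * ((?E / lambda L q) powr (2 / 3) * 2 powr (- (real q * ?s)))"
          using A1 by (intro mult_right_mono) auto
        finally show ?thesis by (simp add: mult.assoc)
      qed
    qed
    then show ?thesis unfolding ab(3) by (rule ennreal_leI)
  qed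
  then show ?thesis using A1 by (intro exI[of _ A]) auto
qed

section \<open>Summation over the dyadic scales\<close>

text \<open>Interpolating between \<open>1\<close> and \<open>x\<^sup>2\<close> replaces the usual splitting of the sum over \<open>q\<close> at the
  scale \<open>\<lambda>\<^sub>q \<ell> = 1\<close>.\<close>

lemma min_one_square_le_powr:
  assumes "0 < (x::real)" "0 \<le> \<theta>" "\<theta> \<le> 2"
  shows "min 1 (x\<^sup>2) \<le> x powr \<theta>"
proof (cases "x \<le> 1")
  case True
  then have "x powr 2 \<le> x powr \<theta>" using assms by (intro powr_mono') auto
  then show ?thesis using assms by (simp add: powr_numeral min.coboundedI2)
next
  case False
  then show ?thesis using assms by (simp add: ge_one_powr_ge_zero min.coboundedI1)
qed

text \<open>The terms are bounded by a geometric sequence of ratio \<open>2\<^bsup>\<theta> - 5/3 + d/3\<^esup>\<close>; the exponents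
  come from \<open>(2\<^sup>q \<ell> / L)\<^sup>\<theta>\<close>, from \<open>\<lambda>\<^sub>q\<^bsup>-2/3\<^esup>\<close> and from the decay of the second moments.\<close>

lemma dyadic_sum_le:
  assumes chi: "lp_cutoff chi" and L: "L > 0" and T: "T > 0" and u: "L2_field T L u"
    and E: "eps_bar chi T L u < \<infinity>" and d: "intermittency_dim chi T L u < ereal d"
    and \<theta>: "0 \<le> \<theta>" "\<theta> \<le> 2" "\<theta> < 5 / 3 - d / 3"
  shows "\<exists>K\<ge>0. \<forall>l. 0 < l \<longrightarrow>
    (\<Sum>q. ennreal (increment_weight (l / L) q) * block_moment chi T L u 2 q)
      \<le> ennreal (enn2real (eps_bar chi T L u) powr (2 / 3) * l powr (2 / 3) * (K * (l / L) powr (\<theta> - 2 / 3)))"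
proof -
  let ?E = "enn2real (eps_bar chi T L u)" and ?s = "1 - d / 3"
  obtain A where A: "A \<ge> 0" and dec: "\<And>q. block_moment chi T L u 2 q
    \<le> ennreal (A * (?E / lambda L q) powr (2 / 3) * 2 powr (- (real q * ?s)))"
    using second_moment_decay[OF chi L T u E d] by blast
  define \<rho> :: real where "\<rho> = 2 powr (\<theta> - 2 / 3 - ?s)"
  have \<rho>: "0 < \<rho>" "\<rho> < 1" using \<theta> powr_less_one[of 2 "\<theta> - 2 / 3 - ?s"] by (simp_all add: \<rho>_def)
  define K where "K = 128 * pi\<^sup>2 * A / (1 - \<rho>)"
  have "(\<Sum>q. ennreal (increment_weight (l / L) q) * block_moment chi T L u 2 q)
      \<le> ennreal (?E powr (2 / 3) * l powr (2 / 3) * (K * (l / L) powr (\<theta> - 2 / 3)))" if l: "0 < l" for l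
  proof -
    define r where "r = l / L"
    have r: "r > 0" using l L by (simp add: r_def)
    define B where "B = 128 * pi\<^sup>2 * A * ?E powr (2 / 3) * L powr (2 / 3) * r powr \<theta>"
    have B0: "B \<ge> 0" using A by (simp add: B_def)
    have summand: "ennreal (increment_weight r q) * block_moment chi T L u 2 q \<le> ennreal (B * \<rho> ^ q)" for q
    proof -
      have w: "increment_weight r q \<le> 128 * pi\<^sup>2 * (2 powr (real q * \<theta>) * r powr \<theta>)"
      proof -
        have "min 1 ((2 ^ q * r)\<^sup>2) \<le> (2 ^ q * r) powr \<theta>"
          using r \<theta> by (intro min_one_square_le_powr) auto
        also have "\<dots> = 2 powr (real q * \<theta>) * r powr \<theta>"
          using r by (simp add: powr_mult powr_realpow[symmetric] powr_powr)
        finally show ?thesis unfolding increment_weight_def by (intro mult_left_mono) auto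
      qed
      have lam: "(?E / lambda L q) powr (2 / 3) = ?E powr (2 / 3) * L powr (2 / 3) * 2 powr (- (real q * (2 / 3)))"
        using L by (simp add: lambda_def powr_divide powr_mult powr_realpow[symmetric] powr_powr powr_minus field_simps)
      have "ennreal (increment_weight r q) * block_moment chi T L u 2 q
         \<le> ennreal (128 * pi\<^sup>2 * (2 powr (real q * \<theta>) * r powr \<theta>)) * ennreal (A * (?E / lambda L q) powr (2 / 3) * 2 powr (- (real q * ?s)))"
        by (intro mult_mono ennreal_leI w dec) auto
      also have "\<dots> = ennreal (128 * pi\<^sup>2 * (2 powr (real q * \<theta>) * r powr \<theta>) * (A * (?E / lambda L q) powr (2 / 3) * 2 powr (- (real q * ?s))))"
        using A by (intro ennreal_mult[symmetric]) auto
      also have "128 * pi\<^sup>2 * (2 powr (real q * \<theta>) * r powr \<theta>) * (A * (?E / lambda L q) powr (2 / 3) * 2 powr (- (real q * ?s)))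
         = B * (2 powr (real q * \<theta>) * 2 powr (- (real q * (2 / 3))) * 2 powr (- (real q * ?s)))"
        unfolding lam B_def by (simp only: mult_ac)
      also have "2 powr (real q * \<theta>) * 2 powr (- (real q * (2 / 3))) * 2 powr (- (real q * ?s)) = \<rho> ^ q"
        using \<rho>(1) by (simp add: \<rho>_def powr_add[symmetric] powr_realpow[symmetric] powr_powr algebra_simps)
      finally show ?thesis .
    qed
    have "(\<Sum>q. ennreal (increment_weight r q) * block_moment chi T L u 2 q) \<le> (\<Sum>q. ennreal (B * \<rho> ^ q))"
      by (intro suminf_le summand) auto
    also have "\<dots> = ennreal (B * (1 / (1 - \<rho>)))"
      using \<rho> B0 by (intro suminf_ennreal_eq sums_mult geometric_sums) auto
    also have "B * (1 / (1 - \<rho>)) = ?E powr (2 / 3) * l powr (2 / 3) * (K * r powr (\<theta> - 2 / 3))"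
    proof -
      have "L powr (2 / 3) * r powr \<theta> = l powr (2 / 3) * r powr (\<theta> - 2 / 3)"
      proof -
        have "l = L * r" using L by (simp add: r_def)
        then have "l powr (2 / 3) = L powr (2 / 3) * r powr (2 / 3)" using L r by (simp add: powr_mult)
        moreover have "r powr \<theta> = r powr (2 / 3) * r powr (\<theta> - 2 / 3)" by (simp add: powr_add[symmetric])
        ultimately show ?thesis by simp
      qed
      then have "B = 128 * pi\<^sup>2 * A * ?E powr (2 / 3) * (l powr (2 / 3) * r powr (\<theta> - 2 / 3))"
        by (simp add: B_def mult.assoc)
      then show ?thesis by (simp add: K_def)
    qed
    finally show ?thesis by (simp add: r_def)
  qed
  moreover have "K \<ge> 0" using A \<rho> by (simp add: K_def)
  ultimately show ?thesis by blast
qed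

text \<open>The area element of the sphere integrates to \<open>4 \<pi>\<close>, the normalising factor.\<close>

lemma structure_fun_le:
  assumes c: "0 \<le> c" and l: "0 < l"
    and le: "\<And>y. norm y = l \<Longrightarrow> avg T L (\<lambda>z. ennreal ((norm (increment y u z))\<^sup>2)) \<le> ennreal c"
  shows "structure_fun T L u l \<le> ennreal c"
proof -
  let ?f = "\<lambda>\<theta>. avg T L (\<lambda>z. ennreal ((norm (increment (l *\<^sub>R \<theta>) u z))\<^sup>2))"
  have unit: "norm (vector [sin b * cos a, sin b * sin a, cos b] :: real^3) = 1" for a b
  proof -
    have "(sin b * cos a)\<^sup>2 + (sin b * sin a)\<^sup>2 + (cos b)\<^sup>2 = (sin b)\<^sup>2 * ((cos a)\<^sup>2 + (sin a)\<^sup>2) + (cos b)\<^sup>2"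
      by (simp only: power_mult_distrib distrib_left)
    also have "\<dots> = 1" by simp
    finally show ?thesis by (simp add: norm_vec_def L2_set_def sum_3)
  qed
  have f: "?f (vector [sin b * cos a, sin b * sin a, cos b]) \<le> ennreal c" for a b
    using l by (intro le) (simp add: unit)
  have sin: "(\<integral>\<^sup>+ b\<in>{0..pi}. ennreal (sin b) \<partial>lborel) = 2"
  proof -
    have "(\<integral>\<^sup>+ b. ennreal (sin b) * indicator {0..pi} b \<partial>lborel) = ennreal ((- cos pi) - (- cos 0))"
      by (rule nn_integral_FTC_Icc[where F="\<lambda>x. - cos x"]) (auto intro!: derivative_eq_intros sin_ge_zero)
    then show ?thesis by simp
  qed
  have "sphere_integral ?f \<le> (\<integral>\<^sup>+ a\<in>{0..2 * pi}. (\<integral>\<^sup>+ b\<in>{0..pi}. ennreal c * ennreal (sin b) \<partial>lborel) \<partial>lborel)"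
    unfolding sphere_integral_def by (intro nn_integral_mono mult_right_mono f) auto
  also have "\<dots> = (\<integral>\<^sup>+ a\<in>{0..2 * pi}. ennreal c * 2 \<partial>lborel)"
    by (simp add: mult.assoc nn_integral_cmult sin)
  also have "\<dots> = ennreal c * 2 * ennreal (2 * pi)"
    by (simp add: nn_integral_cmult_indicator)
  also have "\<dots> = ennreal (c * (4 * pi))"
    using c by (simp add: ennreal_mult[symmetric] ennreal_numeral[symmetric] del: ennreal_numeral)
  finally have "structure_fun T L u l \<le> ennreal (c * (4 * pi)) / ennreal (4 * pi)"
    unfolding structure_fun_def by (rule divide_right_mono_ennreal)
  also have "\<dots> = ennreal c" using c by (simp add: divide_ennreal)
  finally show ?thesis .
qed

lemma structure_fun_power_bound:
  assumes chi: "lp_cutoff chi" and L: "L > 0" and T: "T > 0" and u: "L2_field T L u"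
    and E: "eps_bar chi T L u < \<infinity>" and d: "intermittency_dim chi T L u < ereal d"
    and \<theta>: "0 \<le> \<theta>" "\<theta> \<le> 2" "\<theta> < 5 / 3 - d / 3"
  shows "\<exists>K\<ge>0. \<forall>l. 0 < l \<longrightarrow> structure_fun T L u l
      \<le> ennreal (enn2real (eps_bar chi T L u) powr (2 / 3) * l powr (2 / 3) * (K * (l / L) powr (\<theta> - 2 / 3)))"
proof -
  obtain K where K: "K \<ge> 0" and le: "\<And>l. 0 < l \<Longrightarrow>
    (\<Sum>q. ennreal (increment_weight (l / L) q) * block_moment chi T L u 2 q)
      \<le> ennreal (enn2real (eps_bar chi T L u) powr (2 / 3) * l powr (2 / 3) * (K * (l / L) powr (\<theta> - 2 / 3)))"
    using dyadic_sum_le[OF chi L T u E d \<theta>] by blast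
  have "structure_fun T L u l
      \<le> ennreal (enn2real (eps_bar chi T L u) powr (2 / 3) * l powr (2 / 3) * (K * (l / L) powr (\<theta> - 2 / 3)))" if l: "0 < l" for l
  proof (rule structure_fun_le[OF _ l])
    fix y :: "real^3" assume y: "norm y = l"
    show "avg T L (\<lambda>z. ennreal ((norm (increment y u z))\<^sup>2))
      \<le> ennreal (enn2real (eps_bar chi T L u) powr (2 / 3) * l powr (2 / 3) * (K * (l / L) powr (\<theta> - 2 / 3)))"
      by (rule order_trans[OF increment_le_blocks[OF chi L u, of y, unfolded y] le[OF l]])
  qed (use K in simp)
  then show ?thesis using K by blast
qed

text \<open>For small \<open>r\<close> the gain \<open>r\<^bsup>s' - s\<^esup>\<close> beats the constant \<open>K\<close>; away from \<open>0\<close> all powers of \<open>r\<close> are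
  comparable and \<open>C\<close> does the work.\<close>

lemma absorb_larger_power:
  assumes K: "0 \<le> (K::real)" and s: "s < s'"
  shows "\<exists>C>0. \<forall>r. 0 < r \<and> r < 1 \<longrightarrow> K * r powr s' \<le> r powr s + C * r powr p"
proof -
  define r0 where "r0 = (1 / (K + 1)) powr (1 / (s' - s))"
  have r0: "0 < r0" using K by (simp add: r0_def)
  have Kr0: "K * r0 powr (s' - s) \<le> 1" using K s by (simp add: r0_def powr_powr)
  define m where "m = min 1 (r0 powr p)"
  have m: "m > 0" using r0 by (simp add: m_def)
  define M where "M = max 1 (r0 powr s') / m"
  have M: "M > 0" using m by (simp add: M_def)
  have "K * r powr s' \<le> r powr s + (K * M + 1) * r powr p" if r: "0 < r" "r < 1" for r
  proof (cases "r \<le> r0")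
    case True
    have "K * r powr s' = K * r powr (s' - s) * r powr s" by (simp add: powr_add[symmetric])
    also have "\<dots> \<le> 1 * r powr s"
    proof (intro mult_right_mono order_trans[OF _ Kr0] mult_left_mono K)
      show "r powr (s' - s) \<le> r0 powr (s' - s)" using True r s by (intro powr_mono2) auto
    qed simp
    finally show ?thesis using K M by (simp add: add_increasing2)
  next
    case False
    have 1: "r powr s' \<le> max 1 (r0 powr s')"
      using False r r0 powr_mono2'[of s' r0 r] powr_le1[of s' r] by (cases "s' \<ge> 0") auto
    have 2: "m \<le> r powr p" unfolding m_def
      using False r r0 powr_mono2[of p r0 r] powr_mono2'[of p r 1] by (cases "p \<ge> 0") auto
    have "r powr s' \<le> M * r powr p"
    proof -
      have "r powr s' \<le> M * m" using 1 m by (simp add: M_def)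
      also have "\<dots> \<le> M * r powr p" using 2 M by simp
      finally show ?thesis .
    qed
    then have "K * r powr s' \<le> K * (M * r powr p)" using K by (rule mult_left_mono)
    also have "\<dots> \<le> r powr s + (K * M + 1) * r powr p" by (simp add: algebra_simps)
    finally show ?thesis .
  qed
  moreover have "K * M + 1 > 0" using K M by (simp add: add_nonneg_pos)
  ultimately show ?thesis by blast
qed

theorem lemma4p7:
  fixes chi :: "real^3 \<Rightarrow> real"
  assumes "lp_cutoff chi"
  shows "\<exists>C\<^sub>2>0. \<forall>L>0. \<forall>T>0. \<forall>u :: real \<times> (real^3) \<Rightarrow> real^3.
    L2_field T L u \<and> incompressible T L u \<and> eps_bar chi T L u < \<infinity> \<longrightarrow>
      (\<forall>\<delta>>0. \<exists>C\<^sub>\<delta>>0. \<forall>l. 0 < l \<and> l < L \<longrightarrow>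
         structure_fun T L u l \<le>
           ennreal (C\<^sub>2 * enn2real (eps_bar chi T L u) powr (2 / 3) * l powr (2 / 3) *
             (intermittency_factor (intermittency_dim chi T L u) \<delta> (l / L)
               + C\<^sub>\<delta> * (l / L) powr (4 / 3))))"
proof (rule exI[of _ 1], intro conjI allI impI)
  fix L T :: real and u :: "real \<times> (real^3) \<Rightarrow> real^3" and \<delta> :: real
  assume L: "0 < L" and T: "0 < T" and \<delta>: "0 < \<delta>"
    and "L2_field T L u \<and> incompressible T L u \<and> eps_bar chi T L u < \<infinity>"
  then have u: "L2_field T L u" and E: "eps_bar chi T L u < \<infinity>" by auto
  define D where "D = intermittency_dim chi T L u"
  define F where "F = intermittency_factor D \<delta>"
  let ?E = "enn2real (eps_bar chi T L u)"
  have D3: "D \<le> 3" unfolding D_def by (rule intermittency_dim_le_3[OF assms L T u E])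
  have F0: "0 \<le> F r" for r by (simp add: F_def intermittency_factor_def)
  \<comment> \<open>For \<open>d < -1\<close> the value \<open>\<theta> = 2\<close> is admissible and gives the power \<open>4 / 3\<close> alone.\<close>
  have bound_if_dim_small: "\<exists>C>0. \<forall>l. 0 < l \<and> l < L \<longrightarrow>
      structure_fun T L u l \<le> ennreal (?E powr (2 / 3) * l powr (2 / 3) * (F (l / L) + C * (l / L) powr (4 / 3)))"
    if d: "D < ereal d" "d < -1" for d
  proof -
    obtain K where K: "K \<ge> 0" and le: "\<And>l. 0 < l \<Longrightarrow> structure_fun T L u l
        \<le> ennreal (?E powr (2 / 3) * l powr (2 / 3) * (K * (l / L) powr (2 - 2 / 3)))"
      using structure_fun_power_bound[OF assms L T u E d(1)[unfolded D_def], of 2] d(2) by auto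
    have "structure_fun T L u l \<le> ennreal (?E powr (2 / 3) * l powr (2 / 3) * (F (l / L) + (K + 1) * (l / L) powr (4 / 3)))"
      if l: "0 < l" for l
    proof (rule order_trans[OF le[OF l]], intro ennreal_leI mult_left_mono)
      show "K * (l / L) powr (2 - 2 / 3) \<le> F (l / L) + (K + 1) * (l / L) powr (4 / 3)"
        using F0[of "l / L"] by (simp add: distrib_right add_increasing)
    qed auto
    then show ?thesis using K by (intro exI[of _ "K + 1"]) auto
  qed
  have "\<exists>C>0. \<forall>l. 0 < l \<and> l < L \<longrightarrow>
      structure_fun T L u l \<le> ennreal (?E powr (2 / 3) * l powr (2 / 3) * (F (l / L) + C * (l / L) powr (4 / 3)))"
  proof (cases D)
    case PInf
    then show ?thesis using D3 by simp
  next
    case MInf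
    then show ?thesis by (intro bound_if_dim_small[of "-2"]) auto
  next
    case (real x)
    have x3: "x \<le> 3" using D3 real by simp
    \<comment> \<open>The \<open>\<delta>\<close> of room in the exponent is spent three times: on replacing the limit superior by a
      number above it, on the convergence of the dyadic sum, and on absorbing the constant \<open>K\<close>.
      The bound \<open>1 / 10\<close> keeps \<open>\<theta> = s' + 2 / 3\<close> nonnegative even for \<open>D = 3\<close>.\<close>
    define \<eta> where "\<eta> = min (\<delta> / 3) (1 / 10)"
    have \<eta>: "0 < \<eta>" "2 * \<eta> < \<delta>" "\<eta> \<le> 1 / 10" using \<delta> by (auto simp: \<eta>_def)
    have Dd: "D < ereal (x + 3 * \<eta>)" using real \<eta> by simp
    define s' where "s' = 1 - x / 3 - 2 * \<eta>"
    show ?thesis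
    proof (cases "x + 3 * \<eta> < -1")
      case True
      then show ?thesis using bound_if_dim_small[OF Dd] by blast
    next
      case False
      then have th: "0 \<le> s' + 2 / 3" "s' + 2 / 3 \<le> 2" "s' + 2 / 3 < 5 / 3 - (x + 3 * \<eta>) / 3"
        using x3 \<eta> by (simp_all add: s'_def field_simps)
      obtain K where K: "K \<ge> 0" and le: "\<And>l. 0 < l \<Longrightarrow> structure_fun T L u l
          \<le> ennreal (?E powr (2 / 3) * l powr (2 / 3) * (K * (l / L) powr (s' + 2 / 3 - 2 / 3)))"
        using structure_fun_power_bound[OF assms L T u E Dd[unfolded D_def] th] by blast
      have "1 - x / 3 - \<delta> < s'" using \<eta> by (simp add: s'_def)
      from absorb_larger_power[OF K this, of "4 / 3"] obtain C where C: "C > 0"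
        "\<And>r. 0 < r \<Longrightarrow> r < 1 \<Longrightarrow> K * r powr s' \<le> r powr (1 - x / 3 - \<delta>) + C * r powr (4 / 3)" by blast
      have "structure_fun T L u l \<le> ennreal (?E powr (2 / 3) * l powr (2 / 3) * (F (l / L) + C * (l / L) powr (4 / 3)))"
        if l: "0 < l" "l < L" for l
      proof (rule order_trans[OF le[OF l(1)]], intro ennreal_leI mult_left_mono)
        show "K * (l / L) powr (s' + 2 / 3 - 2 / 3) \<le> F (l / L) + C * (l / L) powr (4 / 3)"
          using C(2)[of "l / L"] l L by (simp add: F_def intermittency_factor_def real)
      qed auto
      then show ?thesis using C(1) by blast
    qed
  qed
  then show "\<exists>C\<^sub>\<delta>>0. \<forall>l. 0 < l \<and> l < L \<longrightarrow>
         structure_fun T L u l \<le>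
           ennreal (1 * enn2real (eps_bar chi T L u) powr (2 / 3) * l powr (2 / 3) *
             (intermittency_factor (intermittency_dim chi T L u) \<delta> (l / L)
               + C\<^sub>\<delta> * (l / L) powr (4 / 3)))"
    by (simp add: F_def D_def)
qed simp

end
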